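(* Consider the Gaussian white noise model. Let $\mathcal{F}\subset L_2(\mathbf{R}^d)$ satisfy $\sup_{g\in\mathcal{F}}\|g\|_2\le B_2<\infty$, let $\mathcal{F}_\delta$, $\delta>0$, be $\delta$-nets of $\mathcal{F}$ with respect to the $L_2$-norm, and define $$\varrho(Q,\mathcal{F}_\delta)=\max\Big\{\frac{\|Q(f-g)\|_2}{\|f-g\|_2}: f\in\mathcal{F}_\delta,\ g\in\mathcal{F}_{2\delta},\ f\ne g\Big\},\qquad G(\delta)=\int_0^\delta\varrho(Q,\mathcal{F}_u)\sqrt{\log_e(\#\mathcal{F}_u)}\,du,\quad \delta\in(0,B_2].$$ Assume that: 1. the entropy integral $G$ converges; 2. $G(\delta)/\delta^2$ is decreasing on the interval $(0,B_2]$; 3. $\varrho(Q,\mathcal{F}_\delta)=c\delta^{-a}$, where $0\le a<1$ and $c>0$; 4. $\lim_{\delta\to0}G(\delta)\delta^{a-1}=\infty$; 5. $\delta\mapsto\varrho(Q,\mathcal{F}_\delta)\sqrt{\log_e(\#\mathcal{F}_\delta)}$ is decreasing on $(0,B_2]$. Let $\hat f\in\mathcal{F}$ be a dense minimizer, i.e. $\gamma_n(\hat f)\le\inf_{g\in\mathcal{F}}\gamma_n(g)+\epsilon_n$, where $\epsilon_n>0$. Let $\psi_n$ be such that $$\psi_n^2\ge Cn^{-1/2}G(\psi_n),$$ where $C$ is a positive constant, and assume that $\lim_{n\to\infty}n\psi_n^{2(1+a)}=\infty$. Then, for $f\in\mathcal{F}$, $$E\|\hat f-f\|_2^2\le C'(\psi_n^2+\epsilon_n)$$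 for a positive constant $C'$, for sufficiently large $n$.
   Context: Setting. $(\mathbf{Y},\mathcal{Y},\nu)$ is a Borel space and $A:L_2(\mathbf{R}^d)\to L_2(\mathbf{Y})$ is a known linear operator ($L_2(\mathbf{R}^d)$ with respect to Lebesgue measure, $L_2(\mathbf{Y})$ with respect to $\nu$; $\|\cdot\|_2$ is the $L_2$-norm). $Q=(A^{-1})^*$ is the adjoint of the inverse of $A$, with domain $L_2(\mathbf{R}^d)$: $\int_{\mathbf{R}^d}(A^{-1}h)g=\int_{\mathbf{Y}}h\,(Qg)\,d\nu$ for $h\in L_2(\mathbf{Y})$, $g\in L_2(\mathbf{R}^d)$. Gaussian white noise model: one observes $dY_n(y)=(Af)(y)\,dy+n^{-1/2}dW(y)$, $y\in\mathbf{Y}$, i.e. $\int h\,dY_n=\int_{\mathbf{Y}}h\,(Af)\,d\nu+n^{-1/2}\int h\,dW$ for $h\in L_2(\mathbf{Y})$, where for $h_1,h_2\in L_2(\mathbf{Y})$ the vector $(\int h_1dW,\int h_2dW)$ is mean-zero Gaussian with variances $\|h_1\|_2^2,\|h_2\|_2^2$ and covariance $\int_{\mathbf{Y}}h_1h_2\,d\nu$; $f$ is the unknown signal function. Empirical risk: $\gamma_n(g)=-2\int_{\mathbf{Y}}(Qg)\,dY_n+\|g\|_2^2$. A $\delta$-net of $\mathcal{F}$ is a finite set $\mathcal{F}_\delta$ such that for each $f\in\mathcal{F}$ there is $\phi\in\mathcal{F}_\delta$ with $\|f-\phi\|_2\le\delta$; $\#\mathcal{F}_\delta$ is its cardinality.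
   Formalization: The Gaussian process g ↦ ∫(Qg)dW on 𝓕 is assumed separable in the L2-distance (a good version), since its finite-dimensional laws alone leave the infimum over an uncountable 𝓕 undetermined and the claim can then fail; the estimator is assumed measurable. *)

theory Defs
  imports "HOL-Probability.Probability"
begin

text \<open>
  Elements of \<open>L\<^sub>2\<close> are represented by square integrable functions.  Identities between elements
  of \<open>L\<^sub>2\<close> are therefore almost-everywhere identities, and operators between \<open>L\<^sub>2\<close> spaces act on
  representatives and respect almost-everywhere equality.
\<close>

definition L2_space :: "'a measure \<Rightarrow> ('a \<Rightarrow> real) set" where
  "L2_space M = {f \<in> borel_measurable M. integrable M (\<lambda>x. (f x)\<^sup>2)}"

definition L2_inner :: "'a measure \<Rightarrow> ('a \<Rightarrow> real) \<Rightarrow> ('a \<Rightarrow> real) \<Rightarrow> real" where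
  "L2_inner M f g = (\<integral>x. f x * g x \<partial>M)"

definition L2_norm :: "'a measure \<Rightarrow> ('a \<Rightarrow> real) \<Rightarrow> real" where
  "L2_norm M f = sqrt (\<integral>x. (f x)\<^sup>2 \<partial>M)"

definition L2_dist :: "'a measure \<Rightarrow> ('a \<Rightarrow> real) \<Rightarrow> ('a \<Rightarrow> real) \<Rightarrow> real" where
  "L2_dist M f g = L2_norm M (\<lambda>x. f x - g x)"

definition L2_eq :: "'a measure \<Rightarrow> ('a \<Rightarrow> real) \<Rightarrow> ('a \<Rightarrow> real) \<Rightarrow> bool" where
  "L2_eq M f g \<longleftrightarrow> (AE x in M. f x = g x)"

definition L2_linear_operator ::
    "'a measure \<Rightarrow> 'b measure \<Rightarrow> (('a \<Rightarrow> real) \<Rightarrow> ('b \<Rightarrow> real)) \<Rightarrow> bool" where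
  "L2_linear_operator M N A \<longleftrightarrow>
     (\<forall>f \<in> L2_space M. A f \<in> L2_space N) \<and>
     (\<forall>f \<in> L2_space M. \<forall>g \<in> L2_space M. L2_eq M f g \<longrightarrow> L2_eq N (A f) (A g)) \<and>
     (\<forall>f \<in> L2_space M. \<forall>g \<in> L2_space M. \<forall>s t.
        L2_eq N (A (\<lambda>x. s * f x + t * g x)) (\<lambda>y. s * A f y + t * A g y))"

definition L2_range ::
    "'a measure \<Rightarrow> 'b measure \<Rightarrow> (('a \<Rightarrow> real) \<Rightarrow> ('b \<Rightarrow> real)) \<Rightarrow> ('b \<Rightarrow> real) set" where
  "L2_range M N A = {h \<in> L2_space N. \<exists>f \<in> L2_space M. L2_eq N h (A f)}"

text \<open>
  The inverse \<open>B\<close> of \<open>A\<close> has domain \<^term>\<open>L2_range M N A\<close>; its existence makes \<open>A\<close> injective.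
  In the ill-posed case this domain is a proper subset of the target space.
\<close>

definition L2_inverse ::
    "'a measure \<Rightarrow> 'b measure \<Rightarrow> (('a \<Rightarrow> real) \<Rightarrow> ('b \<Rightarrow> real)) \<Rightarrow>
     (('b \<Rightarrow> real) \<Rightarrow> ('a \<Rightarrow> real)) \<Rightarrow> bool" where
  "L2_inverse M N A B \<longleftrightarrow>
     (\<forall>f \<in> L2_space M. \<forall>h \<in> L2_space N.
        L2_eq N h (A f) \<longrightarrow> B h \<in> L2_space M \<and> L2_eq M (B h) f)"

text \<open>
  Hilbert space adjoint of a possibly unbounded linear operator \<open>T\<close> from \<open>D \<subseteq> L\<^sub>2(N)\<close> to
  \<open>L\<^sub>2(M)\<close>.  Values are taken in the closure of \<open>D\<close>, on which \<open>T\<close> is densely defined; this makes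
  them unique almost everywhere and is no restriction when \<open>D\<close> is dense in \<open>L\<^sub>2(N)\<close>.
\<close>

definition L2_closure :: "'a measure \<Rightarrow> ('a \<Rightarrow> real) set \<Rightarrow> ('a \<Rightarrow> real) set" where
  "L2_closure M D = {h \<in> L2_space M. \<forall>e>0. \<exists>k \<in> D. L2_dist M h k < e}"

definition L2_adjoint_at ::
    "'b measure \<Rightarrow> 'a measure \<Rightarrow> ('b \<Rightarrow> real) set \<Rightarrow> (('b \<Rightarrow> real) \<Rightarrow> ('a \<Rightarrow> real)) \<Rightarrow>
     ('a \<Rightarrow> real) \<Rightarrow> ('b \<Rightarrow> real) \<Rightarrow> bool" where
  "L2_adjoint_at N M D T g k \<longleftrightarrow>
     g \<in> L2_space M \<and> k \<in> L2_closure N D \<and> (\<forall>h \<in> D. L2_inner M (T h) g = L2_inner N h k)"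

definition L2_adjoint_domain ::
    "'b measure \<Rightarrow> 'a measure \<Rightarrow> ('b \<Rightarrow> real) set \<Rightarrow> (('b \<Rightarrow> real) \<Rightarrow> ('a \<Rightarrow> real)) \<Rightarrow>
     ('a \<Rightarrow> real) set" where
  "L2_adjoint_domain N M D T = {g. \<exists>k. L2_adjoint_at N M D T g k}"

definition L2_adjoint ::
    "'b measure \<Rightarrow> 'a measure \<Rightarrow> ('b \<Rightarrow> real) set \<Rightarrow> (('b \<Rightarrow> real) \<Rightarrow> ('a \<Rightarrow> real)) \<Rightarrow>
     (('a \<Rightarrow> real) \<Rightarrow> ('b \<Rightarrow> real)) \<Rightarrow> bool" where
  "L2_adjoint N M D T Q \<longleftrightarrow> (\<forall>g \<in> L2_adjoint_domain N M D T. L2_adjoint_at N M D T g (Q g))"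

definition centered_gaussian :: "'w measure \<Rightarrow> ('w \<Rightarrow> real) \<Rightarrow> real \<Rightarrow> bool" where
  "centered_gaussian \<Omega> X v \<longleftrightarrow>
     X \<in> borel_measurable \<Omega> \<and> 0 \<le> v \<and>
     distr \<Omega> borel X =
       (if v = 0 then return borel 0 else density lborel (\<lambda>x. ennreal (normal_density 0 (sqrt v) x)))"

text \<open>
  A vector is Gaussian iff all linear combinations of its coordinates are; point masses count as
  Gaussian with variance zero.
\<close>

definition centered_gaussian_pair ::
    "'w measure \<Rightarrow> ('w \<Rightarrow> real) \<Rightarrow> ('w \<Rightarrow> real) \<Rightarrow> real \<Rightarrow> real \<Rightarrow> real \<Rightarrow> bool" where
  "centered_gaussian_pair \<Omega> X Y v w r \<longleftrightarrow>
     (\<forall>s t. centered_gaussian \<Omega> (\<lambda>\<omega>. s * X \<omega> + t * Y \<omega>) (s\<^sup>2 * v + 2 * s * t * r + t\<^sup>2 * w))"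

text \<open>\<open>W h \<omega>\<close> is the value at \<open>\<omega>\<close> of the stochastic integral of \<open>h\<close> against the white noise.\<close>

definition white_noise ::
    "'w measure \<Rightarrow> 'y measure \<Rightarrow> (('y \<Rightarrow> real) \<Rightarrow> 'w \<Rightarrow> real) \<Rightarrow> bool" where
  "white_noise \<Omega> \<nu> W \<longleftrightarrow>
     (\<forall>h1 \<in> L2_space \<nu>. \<forall>h2 \<in> L2_space \<nu>.
        centered_gaussian_pair \<Omega> (W h1) (W h2)
          ((L2_norm \<nu> h1)\<^sup>2) ((L2_norm \<nu> h2)\<^sup>2) (L2_inner \<nu> h1 h2))"

definition observation_integral ::
    "'y measure \<Rightarrow> (('x \<Rightarrow> real) \<Rightarrow> ('y \<Rightarrow> real)) \<Rightarrow> (('y \<Rightarrow> real) \<Rightarrow> 'w \<Rightarrow> real) \<Rightarrow>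
     ('x \<Rightarrow> real) \<Rightarrow> nat \<Rightarrow> ('y \<Rightarrow> real) \<Rightarrow> 'w \<Rightarrow> real" where
  "observation_integral \<nu> A W f n h \<omega> =
     L2_inner \<nu> h (A f) + real n powr (-1/2) * W h \<omega>"

definition empirical_risk ::
    "'x measure \<Rightarrow> 'y measure \<Rightarrow> (('x \<Rightarrow> real) \<Rightarrow> ('y \<Rightarrow> real)) \<Rightarrow> (('x \<Rightarrow> real) \<Rightarrow> ('y \<Rightarrow> real)) \<Rightarrow>
     (('y \<Rightarrow> real) \<Rightarrow> 'w \<Rightarrow> real) \<Rightarrow> ('x \<Rightarrow> real) \<Rightarrow> nat \<Rightarrow> ('x \<Rightarrow> real) \<Rightarrow> 'w \<Rightarrow> real" where
  "empirical_risk M \<nu> A Q W f n g \<omega> =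
     - 2 * observation_integral \<nu> A W f n (Q g) \<omega> + (L2_norm M g)\<^sup>2"

text \<open>
  The law of the white noise fixes each random variable \<open>W h\<close> only up to a null set depending on
  \<open>h\<close>, so an infimum over an uncountable class is meaningful only for a suitable version of the
  process.  This is Doob's separability with respect to the \<open>L\<^sub>2\<close> distance on the index set.
\<close>

definition separable_process ::
    "'w measure \<Rightarrow> 'x measure \<Rightarrow> ('x \<Rightarrow> real) set \<Rightarrow> (('x \<Rightarrow> real) \<Rightarrow> 'w \<Rightarrow> real) \<Rightarrow> bool" where
  "separable_process \<Omega> M F X \<longleftrightarrow>
     (\<exists>F0 \<subseteq> F. countable F0 \<and>
        (AE \<omega> in \<Omega>. \<forall>g \<in> F. \<exists>s :: nat \<Rightarrow> 'x \<Rightarrow> real.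
           range s \<subseteq> F0 \<and> (\<lambda>k. L2_dist M (s k) g) \<longlonglongrightarrow> 0 \<and> (\<lambda>k. X (s k) \<omega>) \<longlonglongrightarrow> X g \<omega>))"

text \<open>For \<open>L\<^sub>2\<close> of a Euclidean space, this is Borel measurability in the norm topology.\<close>

definition L2_random_element ::
    "'w measure \<Rightarrow> 'x measure \<Rightarrow> ('w \<Rightarrow> 'x \<Rightarrow> real) \<Rightarrow> bool" where
  "L2_random_element \<Omega> M X \<longleftrightarrow>
     (\<forall>\<omega> \<in> space \<Omega>. X \<omega> \<in> L2_space M) \<and>
     (\<forall>g \<in> L2_space M. (\<lambda>\<omega>. L2_dist M (X \<omega>) g) \<in> borel_measurable \<Omega>)"

text \<open>
  Distinct members of a net are required to be distinct as elements of \<open>L\<^sub>2\<close>, so that \<open>card\<close> counts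
  elements of \<open>L\<^sub>2\<close>.  A net need not be contained in \<open>F\<close>.
\<close>

definition L2_net ::
    "'x measure \<Rightarrow> real \<Rightarrow> ('x \<Rightarrow> real) set \<Rightarrow> ('x \<Rightarrow> real) set \<Rightarrow> bool" where
  "L2_net M \<delta> F N \<longleftrightarrow>
     finite N \<and> N \<subseteq> L2_space M \<and> pairwise (\<lambda>f g. \<not> L2_eq M f g) N \<and>
     (\<forall>f \<in> F. \<exists>\<phi> \<in> N. L2_dist M f \<phi> \<le> \<delta>)"

definition net_operator_norm ::
    "'x measure \<Rightarrow> 'y measure \<Rightarrow> (('x \<Rightarrow> real) \<Rightarrow> ('y \<Rightarrow> real)) \<Rightarrow>
     (real \<Rightarrow> ('x \<Rightarrow> real) set) \<Rightarrow> real \<Rightarrow> real" where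
  "net_operator_norm M \<nu> Q N \<delta> =
     Max {L2_norm \<nu> (Q (\<lambda>x. f x - g x)) / L2_norm M (\<lambda>x. f x - g x) | f g.
            f \<in> N \<delta> \<and> g \<in> N (2 * \<delta>) \<and> \<not> L2_eq M f g}"

definition entropy_integrand ::
    "'x measure \<Rightarrow> 'y measure \<Rightarrow> (('x \<Rightarrow> real) \<Rightarrow> ('y \<Rightarrow> real)) \<Rightarrow>
     (real \<Rightarrow> ('x \<Rightarrow> real) set) \<Rightarrow> real \<Rightarrow> real" where
  "entropy_integrand M \<nu> Q N u = net_operator_norm M \<nu> Q N u * sqrt (ln (real (card (N u))))"

definition entropy_integral ::
    "'x measure \<Rightarrow> 'y measure \<Rightarrow> (('x \<Rightarrow> real) \<Rightarrow> ('y \<Rightarrow> real)) \<Rightarrow>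
     (real \<Rightarrow> ('x \<Rightarrow> real) set) \<Rightarrow> real \<Rightarrow> real" where
  "entropy_integral M \<nu> Q N \<delta> = (LINT u:{0<..\<delta>}|lborel. entropy_integrand M \<nu> Q N u)"

end

theory Submission
  imports Defs
begin

text \<open>
  Since \<open>Q\<close> is the adjoint of \<open>A\<^sup>-\<^sup>1\<close>, the empirical risk satisfies
  \<open>\<gamma>\<^sub>n(g) - \<gamma>\<^sub>n(f) = \<parallel>g - f\<parallel>\<^sup>2 - 2 n\<^sup>-\<^sup>1\<^sup>/\<^sup>2 (W(Qg) - W(Qf))\<close>, so everything rests on the modulus of the
  process \<open>W \<circ> Q\<close> around \<open>f\<close>.  Chaining through the nets at the levels \<open>R / 2\<^sup>k\<close>, rooted at a single point
  of the \<open>2R\<close>-net near \<open>f\<close>, bounds this modulus on the ball of radius \<open>5R\<close> by \<open>K (1 + t) G(R)\<close> off an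
  event of probability at most \<open>4 exp(-t\<^sup>2)\<close>; the fluctuation term \<open>R\<^sup>1\<^sup>-\<^sup>a\<close> is absorbed by \<open>G(R)\<close>
  thanks to the limit assumption on \<open>G\<close>.  As \<open>G\<close> is concave, \<open>n\<^sup>-\<^sup>1\<^sup>/\<^sup>2 G(R) \<le> R \<psi>\<^sub>n / C\<close> for \<open>R \<ge> \<psi>\<^sub>n\<close>, and
  peeling over the shells \<open>R = 2\<^sup>j \<psi>\<^sub>n\<close> with \<open>t\<close> proportional to \<open>2\<^sup>j\<close> gives the risk bound for any \<open>C\<close>.
\<close>

subsection \<open>Square integrable functions\<close>

lemma L2_spaceD:
  assumes "f \<in> L2_space M"
  shows "f \<in> borel_measurable M" "integrable M (\<lambda>x. (f x)\<^sup>2)"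
  using assms by (auto simp: L2_space_def)

lemma integrable_mult_L2:
  assumes "f \<in> L2_space M" "g \<in> L2_space M"
  shows "integrable M (\<lambda>x. f x * g x)"
proof (rule Bochner_Integration.integrable_bound)
  note [measurable] = L2_spaceD(1)[OF assms(1)] L2_spaceD(1)[OF assms(2)]
  show "integrable M (\<lambda>x. (f x)\<^sup>2 + (g x)\<^sup>2)"
    using assms by (auto simp: L2_space_def)
  show "(\<lambda>x. f x * g x) \<in> borel_measurable M" by measurable
  have "\<bar>u * v\<bar> \<le> u\<^sup>2 + v\<^sup>2" for u v :: real
  proof -
    have "2 * (\<bar>u\<bar> * \<bar>v\<bar>) \<le> u\<^sup>2 + v\<^sup>2"
      using sum_squares_bound[of "\<bar>u\<bar>" "\<bar>v\<bar>"] by simp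
    moreover have "0 \<le> \<bar>u\<bar> * \<bar>v\<bar>" by simp
    ultimately show ?thesis unfolding abs_mult by linarith
  qed
  then show "AE x in M. norm (f x * g x) \<le> norm ((f x)\<^sup>2 + (g x)\<^sup>2)" by simp
qed

lemma L2_space_lincomb:
  assumes "f \<in> L2_space M" "g \<in> L2_space M"
  shows "(\<lambda>x. s * f x + t * g x) \<in> L2_space M"
proof -
  note [measurable] = L2_spaceD(1)[OF assms(1)] L2_spaceD(1)[OF assms(2)]
  have "integrable M (\<lambda>x. s\<^sup>2 * (f x)\<^sup>2 + 2 * s * t * (f x * g x) + t\<^sup>2 * (g x)\<^sup>2)"
    using assms integrable_mult_L2[OF assms] by (auto simp: L2_space_def)
  then have "integrable M (\<lambda>x. (s * f x + t * g x)\<^sup>2)"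
    by (rule Bochner_Integration.integrable_cong[THEN iffD1, rotated 2])
       (auto simp: power2_eq_square algebra_simps)
  then show ?thesis by (auto simp: L2_space_def)
qed

lemma L2_space_diff: "f \<in> L2_space M \<Longrightarrow> g \<in> L2_space M \<Longrightarrow> (\<lambda>x. f x - g x) \<in> L2_space M"
  using L2_space_lincomb[of f M g 1 "-1"] by simp

lemma L2_norm_nonneg [simp]: "0 \<le> L2_norm M f"
  by (simp add: L2_norm_def)

lemma L2_dist_nonneg [simp]: "0 \<le> L2_dist M f g"
  by (simp add: L2_dist_def)

lemma L2_norm_square: "(L2_norm M f)\<^sup>2 = (\<integral>x. (f x)\<^sup>2 \<partial>M)"
  by (simp add: L2_norm_def)

lemma L2_inner_self: "L2_inner M f f = (L2_norm M f)\<^sup>2"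
  unfolding L2_norm_square by (simp add: L2_inner_def power2_eq_square)

lemma L2_inner_commute: "L2_inner M f g = L2_inner M g f"
  by (simp add: L2_inner_def mult.commute)

lemma L2_dist_commute: "L2_dist M f g = L2_dist M g f"
  by (simp add: L2_dist_def L2_norm_def power2_commute)

lemma L2_dist_self [simp]: "L2_dist M f f = 0"
  by (simp add: L2_dist_def L2_norm_def)

lemma L2_inner_diff_right:
  assumes "f \<in> L2_space M" "g \<in> L2_space M" "h \<in> L2_space M"
  shows "L2_inner M f (\<lambda>x. g x - h x) = L2_inner M f g - L2_inner M f h"
  unfolding L2_inner_def
  using integrable_mult_L2[OF assms(1,2)] integrable_mult_L2[OF assms(1,3)]
  by (simp add: right_diff_distrib)

lemma L2_inner_diff_left:
  assumes "f \<in> L2_space M" "g \<in> L2_space M" "h \<in> L2_space M"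
  shows "L2_inner M (\<lambda>x. g x - h x) f = L2_inner M g f - L2_inner M h f"
  using L2_inner_diff_right[OF assms] by (simp add: L2_inner_commute)

lemma L2_norm_lincomb_square:
  assumes "f \<in> L2_space M" "g \<in> L2_space M"
  shows "(L2_norm M (\<lambda>x. s * f x + t * g x))\<^sup>2 =
    s\<^sup>2 * (L2_norm M f)\<^sup>2 + 2 * s * t * L2_inner M f g + t\<^sup>2 * (L2_norm M g)\<^sup>2"
proof -
  have "(\<integral>x. (s * f x + t * g x)\<^sup>2 \<partial>M)
      = (\<integral>x. s\<^sup>2 * (f x)\<^sup>2 + 2 * s * t * (f x * g x) + t\<^sup>2 * (g x)\<^sup>2 \<partial>M)"
    by (rule Bochner_Integration.integral_cong) (auto simp: power2_eq_square algebra_simps)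
  also have "\<dots> = s\<^sup>2 * (\<integral>x. (f x)\<^sup>2 \<partial>M) + 2 * s * t * (\<integral>x. f x * g x \<partial>M) + t\<^sup>2 * (\<integral>x. (g x)\<^sup>2 \<partial>M)"
    using assms integrable_mult_L2[OF assms] by (simp add: L2_space_def)
  finally show ?thesis by (simp add: L2_norm_square L2_inner_def)
qed

lemma L2_dist_square:
  assumes "f \<in> L2_space M" "g \<in> L2_space M"
  shows "(L2_dist M f g)\<^sup>2 = (L2_norm M f)\<^sup>2 - 2 * L2_inner M f g + (L2_norm M g)\<^sup>2"
  using L2_norm_lincomb_square[OF assms, of 1 "-1"] by (simp add: L2_dist_def)

text \<open>The squared norm of \<open>s * f + t * g\<close> is a nonnegative quadratic form in
  \<open>s\<close> and \<open>t\<close>. Its value at \<open>s = ?c\<close>, \<open>t = - ?b\<close>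
  gives the discriminant inequality; if \<open>?c = 0\<close>, a nonzero \<open>?b\<close> would let
  the form take the value -1.\<close>

lemma L2_Cauchy_Schwarz:
  assumes "f \<in> L2_space M" "g \<in> L2_space M"
  shows "\<bar>L2_inner M f g\<bar> \<le> L2_norm M f * L2_norm M g"
proof -
  let ?a = "(L2_norm M f)\<^sup>2" and ?b = "L2_inner M f g" and ?c = "(L2_norm M g)\<^sup>2"
  have q: "0 \<le> s\<^sup>2 * ?a + 2 * s * t * ?b + t\<^sup>2 * ?c" for s t
    using zero_le_power2[of "L2_norm M (\<lambda>x. s * f x + t * g x)"] L2_norm_lincomb_square[OF assms, of s t]
    by linarith
  have "?b\<^sup>2 \<le> ?a * ?c"
  proof (cases "?c = 0")
    case True
    have "?b = 0"
    proof (rule ccontr)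
      assume "?b \<noteq> 0"
      with q[of 1 "- (?a + 1) / (2 * ?b)"] True show False by (simp add: field_simps)
    qed
    with True show ?thesis by simp
  next
    case False
    then have "0 < ?c" by simp
    moreover have "0 \<le> ?c * (?a * ?c - ?b\<^sup>2)"
      using q[of ?c "- ?b"] by (simp add: power2_eq_square algebra_simps)
    ultimately show ?thesis by (simp add: zero_le_mult_iff)
  qed
  then have "\<bar>?b\<bar>\<^sup>2 \<le> (L2_norm M f * L2_norm M g)\<^sup>2" by (simp add: power_mult_distrib)
  then show ?thesis by (rule power2_le_imp_le) simp
qed

lemma L2_norm_triangle:
  assumes "f \<in> L2_space M" "g \<in> L2_space M"
  shows "L2_norm M (\<lambda>x. f x + g x) \<le> L2_norm M f + L2_norm M g"
proof (rule power2_le_imp_le)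
  have "(L2_norm M (\<lambda>x. f x + g x))\<^sup>2 = (L2_norm M f)\<^sup>2 + 2 * L2_inner M f g + (L2_norm M g)\<^sup>2"
    using L2_norm_lincomb_square[OF assms, of 1 1] by simp
  also have "\<dots> \<le> (L2_norm M f + L2_norm M g)\<^sup>2"
    using L2_Cauchy_Schwarz[OF assms] by (simp add: power2_sum)
  finally show "(L2_norm M (\<lambda>x. f x + g x))\<^sup>2 \<le> (L2_norm M f + L2_norm M g)\<^sup>2" .
qed simp

lemma L2_dist_triangle:
  assumes "f \<in> L2_space M" "g \<in> L2_space M" "h \<in> L2_space M"
  shows "L2_dist M f h \<le> L2_dist M f g + L2_dist M g h"
  using L2_norm_triangle[OF L2_space_diff[OF assms(1,2)] L2_space_diff[OF assms(2,3)]]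
  by (simp add: L2_dist_def)

lemma L2_dist_le_norms:
  assumes "f \<in> L2_space M" "g \<in> L2_space M"
  shows "L2_dist M f g \<le> L2_norm M f + L2_norm M g"
  using L2_dist_triangle[OF assms(1) _ assms(2), of "\<lambda>_. 0"]
  by (simp add: L2_dist_def L2_space_def L2_norm_def)

lemma L2_eq_iff_dist_0:
  assumes "f \<in> L2_space M" "g \<in> L2_space M"
  shows "L2_eq M f g \<longleftrightarrow> L2_dist M f g = 0"
  using integral_nonneg_eq_0_iff_AE[of M "\<lambda>x. (f x - g x)\<^sup>2"] L2_space_diff[OF assms]
  by (auto simp: L2_eq_def L2_dist_def L2_norm_def L2_space_def)

lemma L2_norm_cong_eq:
  assumes "f \<in> L2_space M" "g \<in> L2_space M" "L2_eq M f g"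
  shows "L2_norm M f = L2_norm M g"
  unfolding L2_norm_def using assms
  by (intro arg_cong[where f = sqrt] integral_cong_AE) (auto simp: L2_space_def L2_eq_def)

subsection \<open>Closedness of the adjoint\<close>

lemma L2_closureD:
  assumes "h \<in> L2_closure M D"
  shows "h \<in> L2_space M" "0 < e \<Longrightarrow> \<exists>k\<in>D. L2_dist M h k < e"
  using assms by (auto simp: L2_closure_def)

lemma L2_adjoint_atD:
  assumes "L2_adjoint_at N M D T g k"
  shows "g \<in> L2_space M" "k \<in> L2_space N" "k \<in> L2_closure N D"
    "h \<in> D \<Longrightarrow> L2_inner M (T h) g = L2_inner N h k"
  using assms L2_closureD(1)[of k N D] by (simp_all add: L2_adjoint_at_def)

lemma L2_closure_diff:
  assumes D: "D \<subseteq> L2_space N" "\<And>h h'. h \<in> D \<Longrightarrow> h' \<in> D \<Longrightarrow> (\<lambda>y. h y - h' y) \<in> D"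
    and k: "k \<in> L2_closure N D" "k' \<in> L2_closure N D"
  shows "(\<lambda>y. k y - k' y) \<in> L2_closure N D"
  unfolding L2_closure_def mem_Collect_eq
proof (intro conjI allI impI)
  have L2: "k \<in> L2_space N" "k' \<in> L2_space N" using k by (auto simp: L2_closure_def)
  then show "(\<lambda>y. k y - k' y) \<in> L2_space N" by (rule L2_space_diff)
  fix e :: real assume "0 < e"
  then have "0 < e / 2" by simp
  from L2_closureD(2)[OF k(1) this] L2_closureD(2)[OF k(2) this]
  obtain h h' where h: "h \<in> D" "h' \<in> D" "L2_dist N k h < e / 2" "L2_dist N k' h' < e / 2"
    by (elim bexE)
  have "L2_dist N (\<lambda>y. k y - k' y) (\<lambda>y. h y - h' y) = L2_norm N (\<lambda>y. (k y - h y) + (h' y - k' y))"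
    unfolding L2_dist_def by (simp add: algebra_simps)
  also have "\<dots> \<le> L2_dist N k h + L2_dist N h' k'"
    unfolding L2_dist_def using D(1) h(1,2) L2 by (intro L2_norm_triangle L2_space_diff) auto
  also have "\<dots> < e" using h by (simp add: L2_dist_commute[of N h'])
  finally show "\<exists>x\<in>D. L2_dist N (\<lambda>y. k y - k' y) x < e" using D(2)[OF h(1,2)] by blast
qed

text \<open>Phrased for pairs in the graph of the adjoint: a map that selects representatives of the
  values is additive only up to null sets.\<close>

lemma L2_adjoint_at_diff:
  assumes D: "D \<subseteq> L2_space N" "\<And>h h'. h \<in> D \<Longrightarrow> h' \<in> D \<Longrightarrow> (\<lambda>y. h y - h' y) \<in> D"
    and T: "\<And>h. h \<in> D \<Longrightarrow> T h \<in> L2_space M"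
    and at: "L2_adjoint_at N M D T g k" "L2_adjoint_at N M D T g' k'"
  shows "L2_adjoint_at N M D T (\<lambda>x. g x - g' x) (\<lambda>y. k y - k' y)"
proof -
  note at1 = L2_adjoint_atD[OF at(1)] and at2 = L2_adjoint_atD[OF at(2)]
  have "L2_inner M (T h) (\<lambda>x. g x - g' x) = L2_inner N h (\<lambda>y. k y - k' y)" if h: "h \<in> D" for h
  proof -
    have hN: "h \<in> L2_space N" using h D(1) by auto
    show ?thesis
      unfolding L2_inner_diff_right[OF T[OF h] at1(1) at2(1)] L2_inner_diff_right[OF hN at1(2) at2(2)]
      by (simp only: at1(4)[OF h] at2(4)[OF h])
  qed
  then show ?thesis
    unfolding L2_adjoint_at_def
    using L2_space_diff[OF at1(1) at2(1)] L2_closure_diff[OF D at1(3) at2(3)] by (intro conjI ballI)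
qed

text \<open>The adjoint identity controls inner products with members of \<open>D\<close> only. For
  \<open>h\<close> in \<open>D\<close> close to \<open>d\<close>, testing against \<open>h\<close>
  is almost testing against \<open>d\<close> itself, so the square of \<open>L2_norm N d\<close> is
  at most \<open>L2_norm N d * K\<close> up to an arbitrarily small error.\<close>

lemma L2_closure_norm_le:
  assumes D: "D \<subseteq> L2_space N" and d: "d \<in> L2_closure N D" and "0 \<le> K"
    and test: "\<And>h. h \<in> D \<Longrightarrow> L2_inner N h d \<le> L2_norm N h * K"
  shows "L2_norm N d \<le> K"
proof -
  have dL2: "d \<in> L2_space N" using d by (simp add: L2_closure_def)
  let ?n = "L2_norm N d"
  have "?n\<^sup>2 \<le> ?n * K + e * (K + ?n)" if "0 < e" for e
  proof -
    obtain h where h: "h \<in> D" "L2_dist N d h < e" using L2_closureD(2)[OF d] \<open>0 < e\<close> by auto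
    then have hL2: "h \<in> L2_space N" using D by auto
    have "L2_norm N h \<le> ?n + L2_dist N h d"
      using L2_norm_triangle[OF dL2 L2_space_diff[OF hL2 dL2]] by (simp add: L2_dist_def)
    then have 1: "L2_norm N h * K \<le> (?n + e) * K"
      using h(2) \<open>0 \<le> K\<close> by (intro mult_right_mono) (auto simp: L2_dist_commute[of N h])
    have "L2_inner N (\<lambda>y. d y - h y) d \<le> L2_dist N d h * ?n"
      using L2_Cauchy_Schwarz[OF L2_space_diff[OF dL2 hL2] dL2] by (simp add: L2_dist_def)
    also have "\<dots> \<le> e * ?n" using h(2) by (intro mult_right_mono) auto
    finally have 2: "L2_inner N (\<lambda>y. d y - h y) d \<le> e * ?n" .
    have "?n\<^sup>2 = L2_inner N h d + L2_inner N (\<lambda>y. d y - h y) d"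
      using L2_inner_diff_left[OF dL2 dL2 hL2] by (simp add: L2_inner_self)
    also have "\<dots> \<le> (?n + e) * K + e * ?n" using 1 2 test[OF h(1)] by linarith
    finally show ?thesis by (simp add: algebra_simps)
  qed
  then have "?n\<^sup>2 \<le> ?n * K + e" if "0 < e" for e
  proof (cases "K + ?n = 0")
    case False
    then have "0 < K + ?n" using \<open>0 \<le> K\<close> L2_norm_nonneg[of N d] by linarith
    with that \<open>\<And>e. 0 < e \<Longrightarrow> ?n\<^sup>2 \<le> ?n * K + e * (K + ?n)\<close>[of "e / (K + ?n)"] show ?thesis by simp
  next
    case True
    then show ?thesis using \<open>0 \<le> K\<close> that L2_norm_nonneg[of N d] by (simp add: add_nonneg_eq_0_iff)
  qed
  then have "?n\<^sup>2 \<le> ?n * K" by (rule field_le_epsilon)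
  then show ?thesis using \<open>0 \<le> K\<close> L2_norm_nonneg[of N d]
    by (cases "?n = 0") (auto simp: power2_eq_square)
qed

text \<open>
  An adjoint is closed: norm bounds pass to limits of arguments, because testing against the domain
  of the original operator turns norm convergence of the arguments into weak convergence of values.
\<close>

lemma L2_adjoint_at_limit_bound:
  assumes D: "D \<subseteq> L2_space N" "\<And>h h'. h \<in> D \<Longrightarrow> h' \<in> D \<Longrightarrow> (\<lambda>y. h y - h' y) \<in> D"
    and T: "\<And>h. h \<in> D \<Longrightarrow> T h \<in> L2_space M"
    and at: "L2_adjoint_at N M D T g k" "L2_adjoint_at N M D T g0 k0"
    and at': "\<And>m :: nat. L2_adjoint_at N M D T (gs m) (ks m)"
    and lim: "(\<lambda>m. L2_dist M (gs m) g) \<longlonglongrightarrow> 0"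
    and bound: "\<And>m. L2_dist N (ks m) k0 \<le> K"
  shows "L2_dist N k k0 \<le> K"
  unfolding L2_dist_def
proof (rule L2_closure_norm_le[OF D(1)])
  show "(\<lambda>y. k y - k0 y) \<in> L2_closure N D"
    by (rule L2_closure_diff[OF D L2_adjoint_atD(3)[OF at(1)] L2_adjoint_atD(3)[OF at(2)]])
  show "0 \<le> K" using bound[of 0] L2_dist_nonneg[of N "ks 0" k0] by linarith
  fix h assume h: "h \<in> D"
  have L2: "h \<in> L2_space N" "T h \<in> L2_space M" "k \<in> L2_space N" "k0 \<in> L2_space N" "ks m \<in> L2_space N"
    "g \<in> L2_space M" "gs m \<in> L2_space M" for m
    by (fact subsetD[OF D(1) h] T[OF h] L2_adjoint_atD(2)[OF at(1)] L2_adjoint_atD(2)[OF at(2)]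
      L2_adjoint_atD(2)[OF at'] L2_adjoint_atD(1)[OF at(1)] L2_adjoint_atD(1)[OF at'])+
  have le: "L2_inner N h (\<lambda>y. k y - k0 y) \<le> L2_norm M (T h) * L2_dist M (gs m) g + L2_norm N h * K" for m
  proof -
    have 1: "L2_inner N h (\<lambda>y. k y - k0 y) =
        L2_inner N h (\<lambda>y. k y - ks m y) + L2_inner N h (\<lambda>y. ks m y - k0 y)"
      by (simp only: L2_inner_diff_right[OF L2(1,3,5)] L2_inner_diff_right[OF L2(1,5,4)]
        L2_inner_diff_right[OF L2(1,3,4)])
    have 2: "L2_inner N h (\<lambda>y. k y - ks m y) = L2_inner M (T h) (\<lambda>x. g x - gs m x)"
      by (rule L2_adjoint_atD(4)[OF L2_adjoint_at_diff[OF D T at(1) at'[of m]] h, symmetric])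
    have 3: "L2_inner M (T h) (\<lambda>x. g x - gs m x) \<le> L2_norm M (T h) * L2_dist M (gs m) g"
      using L2_Cauchy_Schwarz[OF L2(2) L2_space_diff[OF L2(6) L2(7)[of m]]]
      unfolding L2_dist_commute[of M "gs m" g] unfolding L2_dist_def by linarith
    have 4: "L2_inner N h (\<lambda>y. ks m y - k0 y) \<le> L2_norm N h * L2_dist N (ks m) k0"
      using L2_Cauchy_Schwarz[OF L2(1) L2_space_diff[OF L2(5)[of m] L2(4)]]
      unfolding L2_dist_def by linarith
    have 5: "L2_norm N h * L2_dist N (ks m) k0 \<le> L2_norm N h * K"
      by (intro mult_left_mono bound L2_norm_nonneg)
    show ?thesis using 1 2 3 4 5 by linarith
  qed
  have "(\<lambda>m. L2_norm M (T h) * L2_dist M (gs m) g + L2_norm N h * K)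
      \<longlonglongrightarrow> L2_norm M (T h) * 0 + L2_norm N h * K"
    by (intro tendsto_intros lim)
  from LIMSEQ_le_const[OF this, of "L2_inner N h (\<lambda>y. k y - k0 y)"] le
  show "L2_inner N h (\<lambda>y. k y - k0 y) \<le> L2_norm N h * K" by simp
qed

text \<open>This is closedness for the constant sequence with arguments \<open>g\<close> and values
  \<open>k'\<close>, compared with \<open>k'\<close> under the bound 0.\<close>

lemma L2_adjoint_at_unique:
  assumes D: "D \<subseteq> L2_space N" "\<And>h h'. h \<in> D \<Longrightarrow> h' \<in> D \<Longrightarrow> (\<lambda>y. h y - h' y) \<in> D"
    and T: "\<And>h. h \<in> D \<Longrightarrow> T h \<in> L2_space M"
    and at: "L2_adjoint_at N M D T g k" "L2_adjoint_at N M D T g k'"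
  shows "L2_dist N k k' = 0"
proof -
  have "L2_dist N k k' \<le> 0"
    by (rule L2_adjoint_at_limit_bound[OF D T at at(2)]) simp_all
  then show ?thesis using L2_dist_nonneg[of N k k'] by linarith
qed

lemma L2_range_diff:
  assumes A: "L2_linear_operator M N A" and h: "h \<in> L2_range M N A" "h' \<in> L2_range M N A"
  shows "(\<lambda>y. h y - h' y) \<in> L2_range M N A"
proof -
  obtain f where hL2: "h \<in> L2_space N" and f: "f \<in> L2_space M" "L2_eq N h (A f)"
    using h(1) unfolding L2_range_def by blast
  obtain f' where h'L2: "h' \<in> L2_space N" and f': "f' \<in> L2_space M" "L2_eq N h' (A f')"
    using h(2) unfolding L2_range_def by blast
  have "L2_eq N (A (\<lambda>x. 1 * f x + (-1) * f' x)) (\<lambda>y. 1 * A f y + (-1) * A f' y)"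
    by (rule A[unfolded L2_linear_operator_def, THEN conjunct2, THEN conjunct2, rule_format, OF f(1) f'(1)])
  then have "AE y in N. A (\<lambda>x. f x - f' x) y = A f y - A f' y" by (simp add: L2_eq_def)
  with f(2) f'(2) have "L2_eq N (\<lambda>y. h y - h' y) (A (\<lambda>x. f x - f' x))"
    unfolding L2_eq_def by eventually_elim simp
  then show ?thesis
    unfolding L2_range_def
    by (intro CollectI conjI bexI[of _ "\<lambda>x. f x - f' x"] L2_space_diff hL2 h'L2 f(1) f'(1))
qed

lemma L2_inner_cong_eq:
  assumes "f \<in> L2_space M" "f' \<in> L2_space M" "g \<in> L2_space M" "g' \<in> L2_space M" "L2_eq M f f'" "L2_eq M g g'"
  shows "L2_inner M f g = L2_inner M f' g'"
  unfolding L2_inner_def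
proof (rule integral_cong_AE)
  show "AE x in M. f x * g x = f' x * g' x"
    using assms(5,6) unfolding L2_eq_def by eventually_elim simp
qed (use assms in \<open>auto simp: L2_space_def\<close>)

subsection \<open>Gaussian tails\<close>

text \<open>Moving the centre to \<open>\<sigma> * s\<close> works because \<open>x^2\<close>
  dominates \<open>(\<sigma> * s)^2 + (x - \<sigma> * s)^2\<close> beyond that point. The moved
  density has total mass one, so integrating gives a tail bound without a further factor.\<close>

lemma normal_density_tail_le:
  assumes "0 < \<sigma>" "0 \<le> s" "\<sigma> * s \<le> x"
  shows "normal_density 0 \<sigma> x \<le> exp (- s\<^sup>2 / 2) * normal_density (\<sigma> * s) \<sigma> x"
proof -
  have "0 \<le> (\<sigma> * s) * (x - \<sigma> * s)" using assms by (intro mult_nonneg_nonneg) auto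
  then have "s\<^sup>2 * \<sigma>\<^sup>2 + (x - \<sigma> * s)\<^sup>2 \<le> x\<^sup>2" by (simp add: power2_eq_square algebra_simps)
  then have "s\<^sup>2 / 2 + (x - \<sigma> * s)\<^sup>2 / (2 * \<sigma>\<^sup>2) \<le> x\<^sup>2 / (2 * \<sigma>\<^sup>2)"
    using \<open>0 < \<sigma>\<close> by (simp add: divide_simps mult.commute)
  then have "exp (- x\<^sup>2 / (2 * \<sigma>\<^sup>2)) \<le> exp (- s\<^sup>2 / 2) * exp (- (x - \<sigma> * s)\<^sup>2 / (2 * \<sigma>\<^sup>2))"
    by (simp add: exp_add[symmetric])
  then show ?thesis
    unfolding normal_density_def using \<open>0 < \<sigma>\<close> by (simp add: divide_right_mono)
qed

lemma centered_gaussian_upper_tail: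
  assumes "prob_space \<Omega>" and X: "centered_gaussian \<Omega> X v" and v: "v \<le> \<sigma>\<^sup>2" and "0 < \<sigma>" "0 \<le> s"
  shows "measure \<Omega> {\<omega> \<in> space \<Omega>. \<sigma> * s < X \<omega>} \<le> exp (- s\<^sup>2 / 2)"
proof -
  interpret prob_space \<Omega> by fact
  have meas [measurable]: "X \<in> borel_measurable \<Omega>" and "0 \<le> v"
    and distr: "distr \<Omega> borel X =
       (if v = 0 then return borel 0 else density lborel (\<lambda>x. ennreal (normal_density 0 (sqrt v) x)))"
    using X by (auto simp: centered_gaussian_def)
  have tail: "measure \<Omega> {\<omega> \<in> space \<Omega>. \<sigma> * s < X \<omega>} = measure (distr \<Omega> borel X) {\<sigma> * s<..}"
    by (subst measure_distr) (auto intro!: arg_cong[where f = "measure \<Omega>"])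
  show ?thesis
  proof (cases "v = 0")
    case True
    have "0 \<le> \<sigma> * s" using assms by simp
    then show ?thesis unfolding tail distr using True by (simp add: measure_return)
  next
    case False
    \<comment> \<open>The true standard deviation \<open>\<tau>\<close> may be smaller than the
      given bound \<open>\<sigma>\<close>. Points beyond \<open>\<sigma> * s\<close> then lie beyond
      \<open>\<tau> * s\<close>, so the density estimate applies with \<open>\<tau>\<close>.\<close>
    define \<tau> where "\<tau> = sqrt v"
    have \<tau>: "0 < \<tau>" "\<tau> \<le> \<sigma>" using False \<open>0 \<le> v\<close> v \<open>0 < \<sigma>\<close> by (auto simp: \<tau>_def real_le_lsqrt)
    have "emeasure (distr \<Omega> borel X) {\<sigma> * s<..}
        = (\<integral>\<^sup>+ x. ennreal (normal_density 0 \<tau> x) * indicator {\<sigma> * s<..} x \<partial>lborel)"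
      unfolding distr \<tau>_def using False by (simp add: emeasure_density)
    also have "\<dots> \<le> (\<integral>\<^sup>+ x. ennreal (exp (- s\<^sup>2 / 2)) * ennreal (normal_density (\<tau> * s) \<tau> x) \<partial>lborel)"
    proof (rule nn_integral_mono)
      fix x
      show "ennreal (normal_density 0 \<tau> x) * indicator {\<sigma> * s<..} x
          \<le> ennreal (exp (- s\<^sup>2 / 2)) * ennreal (normal_density (\<tau> * s) \<tau> x)"
      proof (cases "\<sigma> * s < x")
        case True
        then have "\<tau> * s \<le> x" using mult_right_mono[OF \<tau>(2) \<open>0 \<le> s\<close>] by linarith
        from normal_density_tail_le[OF \<tau>(1) \<open>0 \<le> s\<close> this] show ?thesis
          using True by (simp add: ennreal_mult[symmetric] ennreal_leI)
      qed simp
    qed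
    also have "\<dots> = ennreal (exp (- s\<^sup>2 / 2)) * (\<integral>\<^sup>+ x. ennreal (normal_density (\<tau> * s) \<tau> x) \<partial>lborel)"
      by (rule nn_integral_cmult) simp
    also have "(\<integral>\<^sup>+ x. ennreal (normal_density (\<tau> * s) \<tau> x) \<partial>lborel) = 1"
      using \<tau>(1) by (subst nn_integral_eq_integral) auto
    finally have "emeasure (distr \<Omega> borel X) {\<sigma> * s<..} \<le> ennreal (exp (- s\<^sup>2 / 2))" by simp
    then show ?thesis unfolding tail by (simp add: measure_def enn2real_leI)
  qed
qed

text \<open>The coefficients (1, -1) and (-1, 1) both produce the variance
  \<open>v - 2 * r + w\<close>; each combination accounts for one side of the tail.\<close>

lemma centered_gaussian_pair_diff_tail:
  assumes "prob_space \<Omega>" and XY: "centered_gaussian_pair \<Omega> X Y v w r"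
    and v: "v - 2 * r + w \<le> \<sigma>\<^sup>2" and "0 < \<sigma>" "0 \<le> s"
  shows "measure \<Omega> {\<omega> \<in> space \<Omega>. \<sigma> * s < \<bar>X \<omega> - Y \<omega>\<bar>} \<le> 2 * exp (- s\<^sup>2 / 2)"
proof -
  interpret prob_space \<Omega> by fact
  have G: "centered_gaussian \<Omega> (\<lambda>\<omega>. X \<omega> - Y \<omega>) (v - 2 * r + w)"
      "centered_gaussian \<Omega> (\<lambda>\<omega>. Y \<omega> - X \<omega>) (v - 2 * r + w)"
    using XY[unfolded centered_gaussian_pair_def, rule_format, of 1 "-1"]
      XY[unfolded centered_gaussian_pair_def, rule_format, of "-1" 1] by simp_all
  have [measurable]: "(\<lambda>\<omega>. X \<omega> - Y \<omega>) \<in> borel_measurable \<Omega>" "(\<lambda>\<omega>. Y \<omega> - X \<omega>) \<in> borel_measurable \<Omega>"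
    using G by (simp_all add: centered_gaussian_def)
  let ?A = "\<lambda>Z. {\<omega> \<in> space \<Omega>. \<sigma> * s < Z \<omega>}"
  have "{\<omega> \<in> space \<Omega>. \<sigma> * s < \<bar>X \<omega> - Y \<omega>\<bar>}
      = ?A (\<lambda>\<omega>. X \<omega> - Y \<omega>) \<union> ?A (\<lambda>\<omega>. Y \<omega> - X \<omega>)"
    by auto
  then have "measure \<Omega> {\<omega> \<in> space \<Omega>. \<sigma> * s < \<bar>X \<omega> - Y \<omega>\<bar>}
      \<le> measure \<Omega> (?A (\<lambda>\<omega>. X \<omega> - Y \<omega>)) + measure \<Omega> (?A (\<lambda>\<omega>. Y \<omega> - X \<omega>))"
    by (simp add: measure_Un_le)
  with centered_gaussian_upper_tail[OF \<open>prob_space \<Omega>\<close> G(1) v \<open>0 < \<sigma>\<close> \<open>0 \<le> s\<close>]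
    centered_gaussian_upper_tail[OF \<open>prob_space \<Omega>\<close> G(2) v \<open>0 < \<sigma>\<close> \<open>0 \<le> s\<close>]
  show ?thesis by linarith
qed

text \<open>Half the squared threshold has three summands: \<open>l k\<close> pays for the number of
  pairs on level \<open>k\<close>, \<open>real k + 1\<close> makes the levels summable because
  \<open>exp (-1) \<le> 1 / 2\<close>, and \<open>t^2\<close> is what remains as confidence.\<close>

lemma (in prob_space) union_tail_bound:
  fixes X :: "'i \<Rightarrow> 'a \<Rightarrow> real" and E :: "nat \<Rightarrow> ('i \<times> 'i) set" and \<sigma> l :: "nat \<Rightarrow> real"
  assumes fin: "\<And>k. finite (E k)" and card: "\<And>k. real (card (E k)) \<le> exp (l k)"
    and l: "\<And>k. 0 \<le> l k"
    and meas: "\<And>k i j. (i, j) \<in> E k \<Longrightarrow> X i \<in> borel_measurable M \<and> X j \<in> borel_measurable M"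
    and tail: "\<And>k i j s. (i, j) \<in> E k \<Longrightarrow> 0 \<le> s \<Longrightarrow>
      prob {\<omega> \<in> space M. \<sigma> k * s < \<bar>X i \<omega> - X j \<omega>\<bar>} \<le> 2 * exp (- s\<^sup>2 / 2)"
  shows "\<exists>B \<in> sets M. prob B \<le> 2 * exp (- t\<^sup>2) \<and>
    (\<forall>\<omega> \<in> space M - B. \<forall>k. \<forall>(i, j) \<in> E k.
      \<bar>X i \<omega> - X j \<omega>\<bar> \<le> \<sigma> k * sqrt (2 * (l k + (real k + 1) + t\<^sup>2)))"
proof -
  define s where "s k = sqrt (2 * (l k + (real k + 1) + t\<^sup>2))" for k
  define L where "L k p = {\<omega> \<in> space M. \<sigma> k * s k < \<bar>X (fst p) \<omega> - X (snd p) \<omega>\<bar>}" for k p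
  define B where "B k = (\<Union>p \<in> E k. L k p)" for k
  have s: "0 \<le> s k" "(s k)\<^sup>2 / 2 = l k + (real k + 1) + t\<^sup>2" for k
    using l[of k] by (auto simp: s_def)
  have L_sets: "L k p \<in> sets M" if "p \<in> E k" for k p
  proof -
    have [measurable]: "X (fst p) \<in> borel_measurable M" "X (snd p) \<in> borel_measurable M"
      using meas[of "fst p" "snd p" k] that by auto
    show ?thesis unfolding L_def by measurable
  qed
  have B_sets: "B k \<in> sets M" for k
    unfolding B_def using fin L_sets by (intro sets.finite_UN) auto
  have prob_B: "prob (B k) \<le> 2 * exp (- t\<^sup>2) * (1 / 2) ^ Suc k" for k
  proof -
    have "prob (B k) \<le> (\<Sum>p \<in> E k. prob (L k p))"
      unfolding B_def using fin L_sets by (intro finite_measure_subadditive_finite) auto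
    also have "\<dots> \<le> (\<Sum>p \<in> E k. 2 * exp (- (s k)\<^sup>2 / 2))"
      unfolding L_def using tail s(1) by (intro sum_mono) auto
    also have "\<dots> = real (card (E k)) * (2 * exp (- (s k)\<^sup>2 / 2))" by simp
    also have "\<dots> \<le> exp (l k) * (2 * exp (- (s k)\<^sup>2 / 2))" by (intro mult_right_mono card) simp
    also have "\<dots> = 2 * exp (- t\<^sup>2) * exp (- (real k + 1))"
    proof -
      have "- (s k)\<^sup>2 / 2 = - l k + - t\<^sup>2 + - (real k + 1)" using s(2)[of k] by simp
      then show ?thesis by (simp only: exp_add) (simp add: exp_minus field_simps)
    qed
    also have "\<dots> \<le> 2 * exp (- t\<^sup>2) * (1 / 2) ^ Suc k"
    proof -
      have "exp (- (real k + 1)) = exp (-1) ^ Suc k"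
        using exp_of_nat_mult[of "Suc k" "-1 :: real"] by (simp add: algebra_simps)
      moreover have "exp (-1) ^ Suc k \<le> (1 / 2 :: real) ^ Suc k"
      proof (rule power_mono)
        show "exp (-1 :: real) \<le> 1 / 2" using exp_ge_add_one_self[of 1] by (simp add: exp_minus field_simps)
      qed simp
      ultimately have "exp (- (real k + 1)) \<le> (1 / 2) ^ Suc k" by linarith
      then show ?thesis by (intro mult_left_mono) auto
    qed
    finally show ?thesis .
  qed
  let ?U = "\<Union>k. B k"
  have sums: "(\<lambda>k. 2 * exp (- t\<^sup>2) * (1 / 2) ^ Suc k) sums (2 * exp (- t\<^sup>2))"
    using sums_mult[OF power_half_series, of "2 * exp (- t\<^sup>2)"] by simp
  have summable: "summable (\<lambda>k. prob (B k))"
    using prob_B by (intro summable_comparison_test'[OF sums_summable[OF sums], of 0]) simp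
  have "prob ?U \<le> (\<Sum>k. prob (B k))"
    using B_sets summable by (intro finite_measure_subadditive_countably) auto
  also have "\<dots> \<le> 2 * exp (- t\<^sup>2)"
    using suminf_le[OF prob_B summable sums_summable[OF sums]] sums_unique[OF sums] by linarith
  finally have "prob ?U \<le> 2 * exp (- t\<^sup>2)" .
  moreover have "?U \<in> sets M" using B_sets by blast
  moreover have "\<forall>\<omega> \<in> space M - ?U. \<forall>k. \<forall>(i, j) \<in> E k. \<bar>X i \<omega> - X j \<omega>\<bar> \<le> \<sigma> k * s k"
    by (force simp: B_def L_def not_less)
  ultimately show ?thesis unfolding s_def by blast
qed

subsection \<open>The entropy integral\<close>

locale decreasing_integrand =
  fixes H :: "real \<Rightarrow> real" and B :: real
  assumes H_nonneg: "u \<in> {0<..B} \<Longrightarrow> 0 \<le> H u"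
    and H_antimono: "antimono_on {0<..B} H"
    and H_integrable: "\<delta> \<in> {0<..B} \<Longrightarrow> set_integrable lborel {0<..\<delta>} H"
begin

definition G :: "real \<Rightarrow> real" where "G \<delta> = (LINT u:{0<..\<delta>}|lborel. H u)"

lemma H_decr: "0 < x \<Longrightarrow> x \<le> y \<Longrightarrow> y \<le> B \<Longrightarrow> H y \<le> H x"
  using H_antimono by (auto simp: monotone_on_def)

lemma G_split:
  assumes "0 < x" "x \<le> y" "y \<le> B"
  shows "G y = G x + (LINT u:{x<..y}|lborel. H u)" "set_integrable lborel {x<..y} H"
proof -
  have iy: "set_integrable lborel {0<..y} H" using assms by (intro H_integrable) auto
  show ixy: "set_integrable lborel {x<..y} H"
    by (rule set_integrable_subset[OF iy]) (use assms in auto)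
  have "{0<..y} = {0<..x} \<union> {x<..y}" using assms by auto
  then show "G y = G x + (LINT u:{x<..y}|lborel. H u)"
    unfolding G_def using assms H_integrable[of x] ixy by (simp add: set_integral_Un)
qed

lemma G_nonneg: "\<delta> \<in> {0<..B} \<Longrightarrow> 0 \<le> G \<delta>"
  unfolding G_def set_lebesgue_integral_def
  by (intro Bochner_Integration.integral_nonneg) (auto simp: indicator_def H_nonneg)

text \<open>A decreasing integrand lies between its values at the end points. Slopes of
  \<open>G\<close> over adjacent intervals are thus separated by the value of \<open>H\<close> at
  the common point, so \<open>G\<close> is concave.\<close>

lemma G_increment:
  assumes "0 < x" "x \<le> y" "y \<le> B"
  shows "(y - x) * H y \<le> G y - G x" "G y - G x \<le> (y - x) * H x"
proof -
  have const: "set_integrable lborel {x<..y} (\<lambda>_. k)" "(LINT u:{x<..y}|lborel. k) = (y - x) * k" for k :: real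
    using assms by (auto simp: set_integrable_def set_integral_const)
  have "(LINT u:{x<..y}|lborel. H y) \<le> (LINT u:{x<..y}|lborel. H u)"
    by (intro set_integral_mono const G_split assms H_decr) (use assms in auto)
  then show "(y - x) * H y \<le> G y - G x" using G_split(1)[OF assms] const(2) by simp
  have "(LINT u:{x<..y}|lborel. H u) \<le> (LINT u:{x<..y}|lborel. H x)"
    by (intro set_integral_mono const G_split assms H_decr) (use assms in auto)
  then show "G y - G x \<le> (y - x) * H x" using G_split(1)[OF assms] const(2) by simp
qed

lemma G_mono:
  assumes "0 < x" "x \<le> y" "y \<le> B"
  shows "G x \<le> G y"
proof -
  have "0 \<le> (y - x) * H y" using assms H_nonneg[of y] by simp
  then show ?thesis using G_increment(1)[OF assms] by linarith
qed

lemma mult_H_le_G: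
  assumes "x \<in> {0<..B}"
  shows "x * H x \<le> G x"
proof -
  have "set_integrable lborel {0<..x} (\<lambda>_. H x)" "(LINT u:{0<..x}|lborel. H x) = x * H x"
    using assms by (auto simp: set_integrable_def set_integral_const)
  moreover have "(LINT u:{0<..x}|lborel. H x) \<le> (LINT u:{0<..x}|lborel. H u)"
    by (intro set_integral_mono calculation H_integrable assms H_decr) (use assms in auto)
  ultimately show ?thesis by (simp add: G_def)
qed

text \<open>Concavity together with the value 0 at the origin makes \<open>G x / x\<close>
  decreasing. Peeling uses this to compare \<open>G\<close> on the outer shells with
  \<open>G\<close> at the rate itself.\<close>

lemma G_ratio:
  assumes "0 < x" "x \<le> y" "y \<le> B"
  shows "G y \<le> y / x * G x"
proof -
  have "G y \<le> G x + (y - x) * H x" using G_increment(2)[OF assms] by simp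
  also have "\<dots> = G x + (y - x) / x * (x * H x)" using assms by simp
  also have "\<dots> \<le> G x + (y - x) / x * G x"
    using assms mult_H_le_G[of x] by (intro add_left_mono mult_left_mono) auto
  also have "\<dots> = y / x * G x" using assms by (simp add: field_simps)
  finally show ?thesis .
qed

text \<open>The mass of \<open>H\<close> between \<open>R / 2 ^ Suc k\<close> and
  \<open>R / 2 ^ k\<close> is at least half of the \<open>k\<close>-th summand, and these masses
  telescope.\<close>

lemma dyadic_sum_le_G:
  assumes "R \<in> {0<..B}"
  shows "(\<Sum>k<n. R / 2 ^ k * H (R / 2 ^ k)) \<le> 2 * G R"
proof -
  have d: "0 < R / 2 ^ k" "R / 2 ^ k \<le> B" for k
  proof -
    have "R / 2 ^ k \<le> R" using assms by (simp add: divide_le_eq)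
    then show "0 < R / 2 ^ k" "R / 2 ^ k \<le> B" using assms by auto
  qed
  have "R / 2 ^ k * H (R / 2 ^ k) \<le> 2 * (G (R / 2 ^ k) - G (R / 2 ^ Suc k))" for k
    using G_increment(1)[OF d(1)[of "Suc k"] _ d(2)[of k]] assms by (simp add: field_simps)
  then have "(\<Sum>k<n. R / 2 ^ k * H (R / 2 ^ k)) \<le> (\<Sum>k<n. 2 * (G (R / 2 ^ k) - G (R / 2 ^ Suc k)))"
    by (rule sum_mono)
  also have "\<dots> = 2 * (G R - G (R / 2 ^ n))"
    unfolding sum_distrib_left[symmetric] using sum_lessThan_telescope'[of "\<lambda>k. G (R / 2 ^ k)" n] by simp
  also have "\<dots> \<le> 2 * G R" using G_nonneg[of "R / 2 ^ n"] d[of n] by auto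
  finally show ?thesis .
qed

text \<open>Near 0 the limit gives the bound with constant 1. Away from 0 the left side is bounded
  and \<open>G\<close> is bounded below by monotonicity, so a larger constant suffices. For
  \<open>B\<close> not positive there is nothing to bound.\<close>

lemma powr_le_G:
  assumes lim: "filterlim (\<lambda>\<delta>. G \<delta> * \<delta> powr (a - 1)) at_top (at_right 0)" and a: "a < 1"
  shows "\<exists>\<kappa>>0. \<forall>R \<in> {0<..B}. R powr (1 - a) \<le> \<kappa> * G R"
proof (cases "0 < B")
  case True
  have "\<forall>\<^sub>F \<delta> in at_right 0. 1 \<le> G \<delta> * \<delta> powr (a - 1)"
    using lim by (simp add: filterlim_at_top)
  then obtain b where b: "0 < b" "\<And>\<delta>. 0 < \<delta> \<Longrightarrow> \<delta> < b \<Longrightarrow> 1 \<le> G \<delta> * \<delta> powr (a - 1)"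
    by (auto simp: eventually_at_right_field)
  define d where "d = min (b / 2) B"
  have d: "0 < d" "d < b" "d \<le> B" using b True by (auto simp: d_def)
  have small: "\<delta> powr (1 - a) \<le> G \<delta>" if "0 < \<delta>" "\<delta> < b" for \<delta>
  proof -
    have "\<delta> powr (1 - a) * 1 \<le> \<delta> powr (1 - a) * (G \<delta> * \<delta> powr (a - 1))"
      using b(2)[OF that] by (intro mult_left_mono) auto
    also have "\<dots> = G \<delta> * (\<delta> powr (1 - a) * \<delta> powr (a - 1))" by simp
    also have "\<delta> powr (1 - a) * \<delta> powr (a - 1) = 1" using that by (simp add: powr_add[symmetric])
    finally show ?thesis by simp
  qed
  \<comment> \<open>The second entry compares the largest value of the power on the interval with
    its value at \<open>d\<close>, a point still inside the range where the limit bound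
    holds.\<close>
  define \<kappa> where "\<kappa> = max 1 ((B / d) powr (1 - a))"
  have "R powr (1 - a) \<le> \<kappa> * G R" if R: "R \<in> {0<..B}" for R
  proof (cases "R < b")
    case True
    have "R powr (1 - a) \<le> 1 * G R" using small True R by simp
    also have "\<dots> \<le> \<kappa> * G R" using G_nonneg[OF R] by (intro mult_right_mono) (auto simp: \<kappa>_def)
    finally show ?thesis .
  next
    case False
    have "R powr (1 - a) \<le> B powr (1 - a)" using R a by (intro powr_mono2) auto
    also have "\<dots> = (B / d) powr (1 - a) * d powr (1 - a)"
      using d True by (simp add: powr_mult[symmetric])
    also have "\<dots> \<le> \<kappa> * G R"
    proof (intro mult_mono)
      have "d powr (1 - a) \<le> G d" using small d by simp
      also have "\<dots> \<le> G R" using d False R by (intro G_mono) auto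
      finally show "d powr (1 - a) \<le> G R" .
    qed (auto simp: \<kappa>_def)
    finally show ?thesis .
  qed
  then show ?thesis by (intro exI[of _ \<kappa>]) (auto simp: \<kappa>_def)
qed (auto intro: exI[of _ 1])

end

subsection \<open>The adjoint on the nets\<close>

locale adjoint_nets =
  fixes M :: "'x measure" and \<nu> :: "'y measure"
    and A Q :: "('x \<Rightarrow> real) \<Rightarrow> ('y \<Rightarrow> real)" and A_inv :: "('y \<Rightarrow> real) \<Rightarrow> ('x \<Rightarrow> real)"
    and F :: "('x \<Rightarrow> real) set" and N :: "real \<Rightarrow> ('x \<Rightarrow> real) set" and B a c :: real
  assumes A: "L2_linear_operator M \<nu> A"
    and A_inv: "L2_inverse M \<nu> A A_inv"
    and Q: "L2_adjoint \<nu> M (L2_range M \<nu> A) A_inv Q"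
    and F_dom: "F \<subseteq> L2_adjoint_domain \<nu> M (L2_range M \<nu> A) A_inv"
    and nets: "\<And>\<delta>. 0 < \<delta> \<Longrightarrow> L2_net M \<delta> F (N \<delta>)"
    and nets_dom: "\<And>\<delta>. 0 < \<delta> \<Longrightarrow> N \<delta> \<subseteq> L2_adjoint_domain \<nu> M (L2_range M \<nu> A) A_inv"
    and a: "0 \<le> a" "a < 1" and c: "0 < c"
    and rho: "\<And>\<delta>. \<delta> \<in> {0<..B} \<Longrightarrow> net_operator_norm M \<nu> Q N \<delta> = c * \<delta> powr (- a)"
begin

abbreviation "D \<equiv> L2_range M \<nu> A"
abbreviation "D_Q \<equiv> L2_adjoint_domain \<nu> M D A_inv"

lemma D_L2: "D \<subseteq> L2_space \<nu>" by (auto simp: L2_range_def)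

lemma D_diff: "h \<in> D \<Longrightarrow> h' \<in> D \<Longrightarrow> (\<lambda>y. h y - h' y) \<in> D"
  by (rule L2_range_diff[OF A])

lemma A_inv_L2: "h \<in> D \<Longrightarrow> A_inv h \<in> L2_space M"
  using A_inv by (auto simp: L2_inverse_def L2_range_def)

lemma Q_at: "g \<in> D_Q \<Longrightarrow> L2_adjoint_at \<nu> M D A_inv g (Q g)"
  using Q by (auto simp: L2_adjoint_def)

lemma D_Q_L2: "g \<in> D_Q \<Longrightarrow> g \<in> L2_space M"
  and Q_L2: "g \<in> D_Q \<Longrightarrow> Q g \<in> L2_space \<nu>"
  using L2_adjoint_atD(1,2)[OF Q_at] by auto

text \<open>Both sides come from adjoint values at the same argument, which agree almost everywhere.
  This turns \<open>net_operator_norm\<close>, a statement on \<open>Q\<close> of a difference, into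
  one on differences of \<open>Q\<close>.\<close>

lemma Q_diff:
  assumes "g \<in> D_Q" "h \<in> D_Q"
  shows "L2_norm \<nu> (Q (\<lambda>x. g x - h x)) = L2_dist \<nu> (Q g) (Q h)"
proof -
  have at: "L2_adjoint_at \<nu> M D A_inv (\<lambda>x. g x - h x) (\<lambda>y. Q g y - Q h y)"
    by (rule L2_adjoint_at_diff[OF D_L2 D_diff A_inv_L2 Q_at[OF assms(1)] Q_at[OF assms(2)]])
  then have dom: "(\<lambda>x. g x - h x) \<in> D_Q" unfolding L2_adjoint_domain_def by blast
  have "L2_dist \<nu> (Q (\<lambda>x. g x - h x)) (\<lambda>y. Q g y - Q h y) = 0"
    by (rule L2_adjoint_at_unique[OF D_L2 D_diff A_inv_L2 Q_at[OF dom] at])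
  then have "L2_eq \<nu> (Q (\<lambda>x. g x - h x)) (\<lambda>y. Q g y - Q h y)"
    by (subst L2_eq_iff_dist_0[OF Q_L2[OF dom] L2_adjoint_atD(2)[OF at]])
  then show ?thesis
    unfolding L2_dist_def by (rule L2_norm_cong_eq[OF Q_L2[OF dom] L2_adjoint_atD(2)[OF at]])
qed

lemma Q_limit_bound:
  assumes "g \<in> D_Q" "h \<in> D_Q" "\<And>m :: nat. gs m \<in> D_Q"
    and "(\<lambda>m. L2_dist M (gs m) g) \<longlonglongrightarrow> 0" "\<And>m. L2_dist \<nu> (Q (gs m)) (Q h) \<le> K"
  shows "L2_dist \<nu> (Q g) (Q h) \<le> K"
  by (rule L2_adjoint_at_limit_bound[OF D_L2 D_diff A_inv_L2 Q_at[OF assms(1)] Q_at[OF assms(2)]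
        Q_at[OF assms(3)] assms(4,5)])

text \<open>\<open>A f\<close> belongs to the domain of \<open>A_inv\<close>, so it is an admissible
  test function for the adjoint. The drift of the observation thereby becomes an inner product with
  the unknown signal.\<close>

lemma inner_A_Q:
  assumes f: "f \<in> L2_space M" and g: "g \<in> D_Q"
  shows "L2_inner \<nu> (Q g) (A f) = L2_inner M g f"
proof -
  have Af: "A f \<in> L2_space \<nu>" using A f by (auto simp: L2_linear_operator_def)
  have eq: "L2_eq \<nu> (A f) (A f)" by (simp add: L2_eq_def)
  have dom: "A f \<in> D" unfolding L2_range_def using Af f eq by blast
  have inv: "A_inv (A f) \<in> L2_space M" "L2_eq M (A_inv (A f)) f"
    using A_inv f Af eq unfolding L2_inverse_def by blast+
  have "L2_inner \<nu> (A f) (Q g) = L2_inner M (A_inv (A f)) g"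
    by (rule L2_adjoint_atD(4)[OF Q_at[OF g] dom, symmetric])
  also have "\<dots> = L2_inner M f g"
    by (rule L2_inner_cong_eq[OF inv(1) f D_Q_L2[OF g] D_Q_L2[OF g] inv(2)]) (simp add: L2_eq_def)
  finally show ?thesis by (simp only: L2_inner_commute[of \<nu> "A f"] L2_inner_commute[of M f])
qed

text \<open>The quotient of this pair is one of those in the finite maximum, whose value is
  \<open>c * \<delta> powr (- a)\<close>. The factor 8 is large enough for every link of the chains,
  see \<open>dist_proj_proj\<close>.\<close>

lemma Q_link:
  assumes \<delta>: "\<delta> \<in> {0<..B}" and \<phi>: "\<phi> \<in> N \<delta>" and \<xi>: "\<xi> \<in> N (2 * \<delta>)"
    and d: "L2_dist M \<phi> \<xi> \<le> 8 * \<delta>"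
  shows "L2_dist \<nu> (Q \<phi>) (Q \<xi>) \<le> 8 * c * \<delta> powr (1 - a)"
proof -
  have dom: "\<phi> \<in> D_Q" "\<xi> \<in> D_Q" using nets_dom[of \<delta>] nets_dom[of "2 * \<delta>"] \<delta> \<phi> \<xi> by auto
  have L2: "\<phi> \<in> L2_space M" "\<xi> \<in> L2_space M" using dom D_Q_L2 by auto
  show ?thesis
  proof (cases "L2_eq M \<phi> \<xi>")
    case True
    then have 0: "L2_dist M \<xi> \<phi> = 0" using L2_eq_iff_dist_0[OF L2] by (simp add: L2_dist_commute)
    \<comment> \<open>Pairs equal almost everywhere are excluded from the maximum. For them the
      closedness bound with the constant sequence \<open>\<xi>\<close> gives distance 0.\<close>
    have "L2_dist \<nu> (Q \<phi>) (Q \<xi>) \<le> 0"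
      by (rule Q_limit_bound[OF dom dom(2)]) (simp_all add: 0)
    also have "0 \<le> 8 * c * \<delta> powr (1 - a)" using c by simp
    finally show ?thesis .
  next
    case False
    let ?r = "\<lambda>f g. L2_norm \<nu> (Q (\<lambda>x. f x - g x)) / L2_norm M (\<lambda>x. f x - g x)"
    let ?S = "{?r f g | f g. f \<in> N \<delta> \<and> g \<in> N (2 * \<delta>) \<and> \<not> L2_eq M f g}"
    have "finite (N \<delta> \<times> N (2 * \<delta>))"
      using nets[of \<delta>] nets[of "2 * \<delta>"] \<delta> by (auto simp: L2_net_def)
    then have "finite ((\<lambda>(f, g). ?r f g) ` (N \<delta> \<times> N (2 * \<delta>)))" by (rule finite_imageI)
    moreover have "?S \<subseteq> (\<lambda>(f, g). ?r f g) ` (N \<delta> \<times> N (2 * \<delta>))"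
    proof
      fix x assume "x \<in> ?S"
      then obtain f g where "x = ?r f g" "f \<in> N \<delta>" "g \<in> N (2 * \<delta>)" by blast
      then show "x \<in> (\<lambda>(f, g). ?r f g) ` (N \<delta> \<times> N (2 * \<delta>))"
        by (intro image_eqI[of _ _ "(f, g)"]) auto
    qed
    ultimately have fin: "finite ?S" by (rule rev_finite_subset)
    have "?r \<phi> \<xi> \<le> Max ?S" using \<phi> \<xi> False by (intro Max_ge fin) blast
    also have "Max ?S = c * \<delta> powr (- a)" using rho[OF \<delta>] by (simp add: net_operator_norm_def)
    finally have r: "?r \<phi> \<xi> \<le> c * \<delta> powr (- a)" .
    have pos: "0 < L2_dist M \<phi> \<xi>"
      using False L2_eq_iff_dist_0[OF L2] L2_dist_nonneg[of M \<phi> \<xi>] by linarith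
    have "L2_dist \<nu> (Q \<phi>) (Q \<xi>) \<le> c * \<delta> powr (- a) * L2_dist M \<phi> \<xi>"
      using r pos unfolding Q_diff[OF dom] L2_dist_def[of M, symmetric] by (simp add: pos_divide_le_eq)
    also have "\<dots> \<le> c * \<delta> powr (- a) * (8 * \<delta>)" using c d by (intro mult_left_mono) auto
    also have "\<dots> = 8 * c * \<delta> powr (1 - a)"
      using \<delta> powr_add[of \<delta> "- a" 1] by (simp add: algebra_simps)
    finally show ?thesis .
  qed
qed

text \<open>One net point is fixed per \<open>g\<close> and \<open>\<delta>\<close>, so that
  consecutive links of a chain share an end point.\<close>

definition proj :: "real \<Rightarrow> ('x \<Rightarrow> real) \<Rightarrow> 'x \<Rightarrow> real" where
  "proj \<delta> g = (SOME \<phi>. \<phi> \<in> N \<delta> \<and> L2_dist M g \<phi> \<le> \<delta>)"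

lemma proj:
  assumes "g \<in> F" "0 < \<delta>"
  shows "proj \<delta> g \<in> N \<delta>" "L2_dist M g (proj \<delta> g) \<le> \<delta>"
    "proj \<delta> g \<in> D_Q" "proj \<delta> g \<in> L2_space M"
proof -
  have "\<exists>\<phi>. \<phi> \<in> N \<delta> \<and> L2_dist M g \<phi> \<le> \<delta>"
    using nets[OF assms(2)] assms(1) by (auto simp: L2_net_def)
  from someI_ex[OF this] show *: "proj \<delta> g \<in> N \<delta>" "L2_dist M g (proj \<delta> g) \<le> \<delta>"
    by (auto simp: proj_def)
  show "proj \<delta> g \<in> D_Q" using * nets_dom[OF assms(2)] by auto
  then show "proj \<delta> g \<in> L2_space M" by (rule D_Q_L2)
qed

lemma F_D_Q: "g \<in> F \<Longrightarrow> g \<in> D_Q" and F_L2: "g \<in> F \<Longrightarrow> g \<in> L2_space M"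
  using F_dom D_Q_L2 by auto

text \<open>For \<open>g = f\<close> this is \<open>3 * \<delta>\<close>, the length of a link
  between consecutive levels; for \<open>g\<close> within \<open>5 * \<delta>\<close> of
  \<open>f\<close> it is at most \<open>8 * \<delta>\<close>, the length of the link to the
  root.\<close>

lemma dist_proj_proj:
  assumes "g \<in> F" "f \<in> F" "0 < \<delta>"
  shows "L2_dist M (proj \<delta> g) (proj (2 * \<delta>) f) \<le> 3 * \<delta> + L2_dist M g f"
proof -
  have "L2_dist M (proj \<delta> g) (proj (2 * \<delta>) f)
      \<le> L2_dist M (proj \<delta> g) g + L2_dist M g (proj (2 * \<delta>) f)"
    using assms by (intro L2_dist_triangle proj F_L2) auto
  moreover have "L2_dist M g (proj (2 * \<delta>) f) \<le> L2_dist M g f + L2_dist M f (proj (2 * \<delta>) f)"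
    using assms by (intro L2_dist_triangle proj F_L2) auto
  moreover have "L2_dist M (proj \<delta> g) g \<le> \<delta>" "L2_dist M f (proj (2 * \<delta>) f) \<le> 2 * \<delta>"
    using proj(2)[of g \<delta>] proj(2)[of f "2 * \<delta>"] assms by (auto simp: L2_dist_commute)
  ultimately show ?thesis by linarith
qed

text \<open>Factor by which \<open>\<delta> powr (1 - a)\<close> shrinks when
  \<open>\<delta>\<close> is halved; it is below 1 because \<open>a < 1\<close>.\<close>

definition q :: real where "q = (1 / 2) powr (1 - a)"

lemma q: "0 < q" "q < 1"
proof -
  have "(1 / 2 :: real) powr (1 - a) < 1 powr (1 - a)" using a by (intro powr_less_mono2) auto
  then show "0 < q" "q < 1" by (auto simp: q_def)
qed

lemma powr_dyadic: "0 \<le> \<delta> \<Longrightarrow> (\<delta> / 2 ^ k) powr (1 - a) = \<delta> powr (1 - a) * q ^ k"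
proof -
  assume "0 \<le> \<delta>"
  have "(\<delta> / 2 ^ k) powr (1 - a) = (\<delta> * (1 / 2) ^ k) powr (1 - a)" by (simp add: power_one_over)
  also have "\<dots> = \<delta> powr (1 - a) * ((1 / 2) ^ k) powr (1 - a)" using \<open>0 \<le> \<delta>\<close> by (simp add: powr_mult)
  also have "((1 / 2) ^ k) powr (1 - a) = q ^ k"
    unfolding q_def by (simp add: powr_realpow[symmetric] powr_powr mult.commute)
  finally show ?thesis .
qed

lemma dyadic_range: "R \<in> {0<..B} \<Longrightarrow> R / 2 ^ k \<in> {0<..B}"
proof -
  assume R: "R \<in> {0<..B}"
  then have "R / 2 ^ k \<le> R" by (simp add: divide_le_eq)
  with R show ?thesis by auto
qed

text \<open>Total of the geometric series with terms \<open>8 * c * q ^ k\<close>, the normalised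
  lengths of the links.\<close>

definition c1 :: real where "c1 = 8 * c / (1 - q)"

lemma c1_pos: "0 < c1" using c q by (simp add: c1_def)

text \<open>
  The links between consecutive dyadic levels have geometrically decreasing lengths, so they can be
  summed up to \<open>g\<close> itself because the adjoint is closed.
\<close>

lemma Q_proj_dist:
  assumes g: "g \<in> F" and \<delta>: "\<delta> \<in> {0<..B}"
  shows "L2_dist \<nu> (Q g) (Q (proj (2 * \<delta>) g)) \<le> c1 * \<delta> powr (1 - a)"
proof (rule Q_limit_bound[where gs = "\<lambda>m. proj (\<delta> / 2 ^ m) g"])
  have pos: "0 < \<delta> / 2 ^ m" for m using \<delta> by simp
  show "g \<in> D_Q" "proj (2 * \<delta>) g \<in> D_Q" "proj (\<delta> / 2 ^ m) g \<in> D_Q" for m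
    using \<delta> by (auto intro: F_D_Q proj(3) g)
  have "(\<lambda>m. \<delta> * (1 / 2) ^ m) \<longlonglongrightarrow> \<delta> * 0"
    by (intro tendsto_intros LIMSEQ_realpow_zero) auto
  then have lim: "(\<lambda>m. \<delta> / 2 ^ m) \<longlonglongrightarrow> 0" by (simp add: power_one_over)
  show "(\<lambda>m. L2_dist M (proj (\<delta> / 2 ^ m) g) g) \<longlonglongrightarrow> 0"
    by (rule tendsto_sandwich[OF _ _ tendsto_const lim])
       (auto simp: L2_dist_commute[of M _ g] intro!: always_eventually proj(2)[OF g pos])
  have link: "L2_dist \<nu> (Q (proj (\<delta> / 2 ^ m) g)) (Q (proj (2 * (\<delta> / 2 ^ m)) g))
      \<le> 8 * c * (\<delta> powr (1 - a) * q ^ m)" for m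
  proof -
    have "L2_dist M (proj (\<delta> / 2 ^ m) g) (proj (2 * (\<delta> / 2 ^ m)) g) \<le> 8 * (\<delta> / 2 ^ m)"
      using dist_proj_proj[OF g g pos, of m] pos[of m] L2_dist_self[of M g] by linarith
    moreover have "0 < 2 * (\<delta> / 2 ^ m)" using pos[of m] by linarith
    ultimately have "L2_dist \<nu> (Q (proj (\<delta> / 2 ^ m) g)) (Q (proj (2 * (\<delta> / 2 ^ m)) g))
        \<le> 8 * c * (\<delta> / 2 ^ m) powr (1 - a)"
      using Q_link[OF dyadic_range[OF \<delta>] proj(1)[OF g pos] proj(1)[OF g]] by blast
    then show ?thesis using powr_dyadic[of \<delta> m] \<delta> by simp
  qed
  have sum: "L2_dist \<nu> (Q (proj (\<delta> / 2 ^ m) g)) (Q (proj (2 * \<delta>) g))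
      \<le> (\<Sum>k<Suc m. 8 * c * \<delta> powr (1 - a) * q ^ k)" for m
  proof (induction m)
    case 0
    show ?case using link[of 0] by simp
  next
    case (Suc m)
    \<comment> \<open>The coarse end of the new link is the fine end of the previous one, so the
      triangle inequality adds the lengths.\<close>
    have "2 * (\<delta> / 2 ^ Suc m) = \<delta> / 2 ^ m" by simp
    then have "L2_dist \<nu> (Q (proj (\<delta> / 2 ^ Suc m) g)) (Q (proj (\<delta> / 2 ^ m) g))
        \<le> 8 * c * (\<delta> powr (1 - a) * q ^ Suc m)"
      using link[of "Suc m"] by simp
    moreover have "L2_dist \<nu> (Q (proj (\<delta> / 2 ^ Suc m) g)) (Q (proj (2 * \<delta>) g))
        \<le> L2_dist \<nu> (Q (proj (\<delta> / 2 ^ Suc m) g)) (Q (proj (\<delta> / 2 ^ m) g))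
          + L2_dist \<nu> (Q (proj (\<delta> / 2 ^ m) g)) (Q (proj (2 * \<delta>) g))"
      using \<delta> by (intro L2_dist_triangle Q_L2 proj(3)[OF g]) auto
    ultimately show ?case using Suc.IH by simp
  qed
  show "L2_dist \<nu> (Q (proj (\<delta> / 2 ^ m) g)) (Q (proj (2 * \<delta>) g)) \<le> c1 * \<delta> powr (1 - a)" for m
  proof -
    have "(\<Sum>k<Suc m. q ^ k) \<le> 1 / (1 - q)"
      using q sum_le_suminf[OF summable_geometric, of q "{..<Suc m}"] suminf_geometric[of q] by simp
    then have "8 * c * \<delta> powr (1 - a) * (\<Sum>k<Suc m. q ^ k) \<le> 8 * c * \<delta> powr (1 - a) * (1 / (1 - q))"
      using c by (intro mult_left_mono) auto
    then show ?thesis using sum[of m] unfolding sum_distrib_left[symmetric] c1_def by simp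
  qed
qed

end

subsection \<open>Chaining\<close>

text \<open>A linear bound separates \<open>t\<close> from the level-dependent part of the
  threshold; \<open>1 \<le> x\<close> is what lets \<open>x\<close> be absorbed by its
  square.\<close>

lemma sqrt_double_le:
  assumes "1 \<le> x" "0 \<le> t"
  shows "sqrt (2 * (x + t\<^sup>2)) \<le> 2 * (x + t)"
proof (rule real_le_lsqrt)
  have sq: "(2 * (x + t))\<^sup>2 = 4 * x\<^sup>2 + 8 * (x * t) + 4 * t\<^sup>2"
    by (simp add: power2_eq_square algebra_simps)
  have "x \<le> x\<^sup>2" "0 \<le> x * t" "0 \<le> t\<^sup>2" using assms by (simp_all add: power2_eq_square)
  then have "2 * x + 2 * t\<^sup>2 \<le> 4 * x\<^sup>2 + 8 * (x * t) + 4 * t\<^sup>2" using assms(1) by linarith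
  then show "2 * (x + t\<^sup>2) \<le> (2 * (x + t))\<^sup>2" unfolding sq by simp
qed (use assms in auto)

locale white_noise_nets =
  adjoint_nets M \<nu> A Q A_inv F N B a c +
  decreasing_integrand "entropy_integrand M \<nu> Q N" B +
  prob_space \<Omega>
  for M :: "'x measure" and \<nu> :: "'y measure" and A Q A_inv F N B a c and \<Omega> :: "'w measure" +
  fixes W :: "('y \<Rightarrow> real) \<Rightarrow> 'w \<Rightarrow> real"
  assumes W: "white_noise \<Omega> \<nu> W"
    and separable: "separable_process \<Omega> M F (\<lambda>g. W (Q g))"
    and G_lim: "filterlim (\<lambda>\<delta>. G \<delta> * \<delta> powr (a - 1)) at_top (at_right 0)"
begin

abbreviation "H \<equiv> entropy_integrand M \<nu> Q N"

text \<open>The variance of the increment is exactly the squared distance between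
  \<open>Q \<phi>\<close> and \<open>Q \<xi>\<close>.\<close>

lemma W_tail:
  assumes "\<phi> \<in> D_Q" "\<xi> \<in> D_Q" "L2_dist \<nu> (Q \<phi>) (Q \<xi>) \<le> \<sigma>" "0 < \<sigma>" "0 \<le> s"
  shows "prob {\<omega> \<in> space \<Omega>. \<sigma> * s < \<bar>W (Q \<phi>) \<omega> - W (Q \<xi>) \<omega>\<bar>} \<le> 2 * exp (- s\<^sup>2 / 2)"
proof (rule centered_gaussian_pair_diff_tail[OF prob_space_axioms])
  have L2: "Q \<phi> \<in> L2_space \<nu>" "Q \<xi> \<in> L2_space \<nu>" using assms by (auto intro: Q_L2)
  then show "centered_gaussian_pair \<Omega> (W (Q \<phi>)) (W (Q \<xi>)) ((L2_norm \<nu> (Q \<phi>))\<^sup>2)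
      ((L2_norm \<nu> (Q \<xi>))\<^sup>2) (L2_inner \<nu> (Q \<phi>) (Q \<xi>))"
    using W by (simp add: white_noise_def)
  show "(L2_norm \<nu> (Q \<phi>))\<^sup>2 - 2 * L2_inner \<nu> (Q \<phi>) (Q \<xi>) + (L2_norm \<nu> (Q \<xi>))\<^sup>2 \<le> \<sigma>\<^sup>2"
    unfolding L2_dist_square[OF L2, symmetric] using assms(3) by (intro power_mono) auto
qed fact+

lemma W_measurable: "\<phi> \<in> D_Q \<Longrightarrow> W (Q \<phi>) \<in> borel_measurable \<Omega>"
proof -
  assume "\<phi> \<in> D_Q"
  then have "centered_gaussian_pair \<Omega> (W (Q \<phi>)) (W (Q \<phi>)) ((L2_norm \<nu> (Q \<phi>))\<^sup>2)
      ((L2_norm \<nu> (Q \<phi>))\<^sup>2) (L2_inner \<nu> (Q \<phi>) (Q \<phi>))"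
    using W Q_L2 by (simp add: white_noise_def)
  from this[unfolded centered_gaussian_pair_def, rule_format, of 1 0]
  show ?thesis by (simp add: centered_gaussian_def)
qed

definition L :: "real \<Rightarrow> real" where "L \<delta> = ln (real (card (N \<delta>)))"

text \<open>A nonempty \<open>F\<close> forces every net to contain a point. This is what makes the
  cardinality the exponential of \<open>L\<close>, since an empty net would have \<open>L\<close>
  equal to 0.\<close>

lemma card_net:
  assumes "F \<noteq> {}" "0 < \<delta>"
  shows "finite (N \<delta>)" "0 \<le> L \<delta>" "real (card (N \<delta>)) = exp (L \<delta>)"
proof -
  show fin: "finite (N \<delta>)" using nets[OF assms(2)] by (simp add: L2_net_def)
  have "N \<delta> \<noteq> {}" using nets[OF assms(2)] assms(1) by (auto simp: L2_net_def)
  with fin have "1 \<le> card (N \<delta>)" by (simp add: Suc_le_eq card_gt_0_iff)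
  then show "0 \<le> L \<delta>" "real (card (N \<delta>)) = exp (L \<delta>)" by (auto simp: L_def)
qed

lemma H_eq: "\<delta> \<in> {0<..B} \<Longrightarrow> H \<delta> = c * \<delta> powr (- a) * sqrt (L \<delta>)"
  by (simp add: entropy_integrand_def rho L_def)

text \<open>The nets are arbitrary, so a coarser one could be far larger than a finer one.
  Monotonicity of the integrand prevents this: with the power form of the operator norm it yields a
  factor \<open>2 powr a\<close>, at most 2, between the square roots.\<close>

lemma L_double:
  assumes "F \<noteq> {}" "0 < \<delta>" "2 * \<delta> \<le> B"
  shows "L (2 * \<delta>) \<le> 4 * L \<delta>"
proof -
  have "H (2 * \<delta>) \<le> H \<delta>" using assms by (intro H_decr) auto
  then have le: "(2 * \<delta>) powr (- a) * sqrt (L (2 * \<delta>)) \<le> \<delta> powr (- a) * sqrt (L \<delta>)"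
    using c assms by (simp add: H_eq mult.assoc)
  have "2 powr (- a) * sqrt (L (2 * \<delta>)) \<le> sqrt (L \<delta>)"
  proof -
    have "\<delta> powr (- a) * (2 powr (- a) * sqrt (L (2 * \<delta>))) \<le> \<delta> powr (- a) * sqrt (L \<delta>)"
      using le assms by (simp add: powr_mult mult_ac)
    moreover have "0 < \<delta> powr (- a)" using assms by simp
    ultimately show ?thesis by (simp only: mult_le_cancel_left_pos)
  qed
  moreover have "1 / 2 * sqrt (L (2 * \<delta>)) \<le> 2 powr (- a) * sqrt (L (2 * \<delta>))"
  proof (rule mult_right_mono)
    have "2 powr (-1 :: real) \<le> 2 powr (- a)" using a by (intro powr_mono) auto
    then show "1 / 2 \<le> (2 :: real) powr (- a)" by (simp add: powr_minus)
  qed (use card_net[OF assms(1), of "2 * \<delta>"] assms in auto)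
  ultimately have "sqrt (L (2 * \<delta>)) \<le> 2 * sqrt (L \<delta>)" by linarith
  also have "2 * sqrt (L \<delta>) = sqrt (4 * L \<delta>)" by (simp add: real_sqrt_mult)
  finally show ?thesis by simp
qed

text \<open>Total weight of the \<open>real k + 1\<close> terms of the thresholds, finite as a
  differentiated geometric series.\<close>

definition S :: real where "S = (\<Sum>k. q ^ k * (real k + 1))"

lemma S: "(\<Sum>k<n. q ^ k * (real k + 1)) \<le> S" "0 < S"
proof -
  have "summable (\<lambda>k. real (Suc k) * q ^ k)"
    using geometric_deriv_sums[of q] q by (auto simp: sums_iff)
  then have sm: "summable (\<lambda>k. q ^ k * (real k + 1))" by (simp add: mult.commute add.commute)
  show le: "(\<Sum>k<n. q ^ k * (real k + 1)) \<le> S" for n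
    unfolding S_def using q by (intro sum_le_suminf[OF sm]) auto
  show "0 < S" using le[of 1] by simp
qed

text \<open>The coarse end on level 0 is a single point because \<open>2 * R\<close> may exceed
  \<open>B\<close>, where \<open>L_double\<close> gives no control on the size of the net.\<close>

definition links :: "real \<Rightarrow> ('x \<Rightarrow> real) \<Rightarrow> nat \<Rightarrow> (('x \<Rightarrow> real) \<times> ('x \<Rightarrow> real)) set" where
  "links R f k = {(\<phi>, \<xi>). \<phi> \<in> N (R / 2 ^ k) \<and>
     \<xi> \<in> (if k = 0 then {proj (2 * R) f} else N (2 * (R / 2 ^ k))) \<and> L2_dist M \<phi> \<xi> \<le> 8 * (R / 2 ^ k)}"

text \<open>The exponent 5 is 1 for the fine net plus 4 for the coarse one through
  \<open>L_double\<close>; on level 0 the coarse side has only one element.\<close>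

lemma finite_links:
  assumes "f \<in> F" "R \<in> {0<..B}"
  shows "finite (links R f k)" "real (card (links R f k)) \<le> exp (5 * L (R / 2 ^ k))"
proof -
  let ?d = "R / 2 ^ k" and ?T = "if k = 0 then {proj (2 * R) f} else N (2 * (R / 2 ^ k))"
  have ne: "F \<noteq> {}" using assms by auto
  have d: "0 < ?d" using assms by simp
  note fin = card_net[OF ne d] card_net[OF ne, of "2 * ?d"]
  have "finite ?T" using fin d by auto
  then have finT: "finite (N ?d \<times> ?T)" using fin by blast
  have sub: "links R f k \<subseteq> N ?d \<times> ?T" by (auto simp: links_def)
  show "finite (links R f k)" by (rule finite_subset[OF sub finT])
  have "real (card ?T) \<le> exp (4 * L ?d)"
  proof (cases k)
    case 0
    then show ?thesis using fin by simp
  next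
    case (Suc j)
    have "R / 2 ^ j \<le> B" using dyadic_range[OF assms(2)] by auto
    then have "L (2 * ?d) \<le> 4 * L ?d" using Suc d by (intro L_double ne) auto
    then show ?thesis using Suc fin d by simp
  qed
  then have "real (card (N ?d)) * real (card ?T) \<le> exp (L ?d) * exp (4 * L ?d)"
    using fin by (intro mult_mono) auto
  also have "\<dots> = exp (5 * L ?d)" by (simp add: exp_add[symmetric])
  finally have "real (card (N ?d \<times> ?T)) \<le> exp (5 * L ?d)" by (simp add: card_cartesian_product)
  moreover have "card (links R f k) \<le> card (N ?d \<times> ?T)" by (rule card_mono[OF finT sub])
  ultimately show "real (card (links R f k)) \<le> exp (5 * L ?d)" by linarith
qed

lemma links_dom:
  assumes "f \<in> F" "R \<in> {0<..B}" "(\<phi>, \<xi>) \<in> links R f k"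
  shows "\<phi> \<in> D_Q" "\<xi> \<in> D_Q" "L2_dist \<nu> (Q \<phi>) (Q \<xi>) \<le> 8 * c * (R / 2 ^ k) powr (1 - a)"
proof -
  have d: "0 < R / 2 ^ k" "0 < 2 * (R / 2 ^ k)" using assms by auto
  have \<phi>: "\<phi> \<in> N (R / 2 ^ k)" and \<xi>: "\<xi> \<in> N (2 * (R / 2 ^ k))" and
    dist: "L2_dist M \<phi> \<xi> \<le> 8 * (R / 2 ^ k)"
    using assms proj(1)[of f "2 * R"] by (auto simp: links_def split: if_splits)
  show "\<phi> \<in> D_Q" "\<xi> \<in> D_Q" using nets_dom[OF d(1)] nets_dom[OF d(2)] \<phi> \<xi> by auto
  show "L2_dist \<nu> (Q \<phi>) (Q \<xi>) \<le> 8 * c * (R / 2 ^ k) powr (1 - a)"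
    by (rule Q_link[OF dyadic_range[OF assms(2)] \<phi> \<xi> dist])
qed

text \<open>The square root splits into an entropy part and a confidence part. The first turns into
  the dyadic sums of \<open>H\<close>, hence into \<open>G R\<close>; the second is summed by the
  geometric decay of the link lengths.\<close>

lemma chain_sum:
  assumes ne: "F \<noteq> {}" and R: "R \<in> {0<..B}" and t: "0 \<le> t"
  shows "(\<Sum>k<n. 8 * c * (R / 2 ^ k) powr (1 - a) *
      sqrt (2 * (5 * L (R / 2 ^ k) + (real k + 1) + t\<^sup>2)))
    \<le> 64 * G R + 16 * c * S * R powr (1 - a) * (1 + t)"
proof -
  have summand: "8 * c * (R / 2 ^ k) powr (1 - a) * sqrt (2 * (5 * L (R / 2 ^ k) + (real k + 1) + t\<^sup>2))
      \<le> 32 * (R / 2 ^ k * H (R / 2 ^ k)) + 16 * c * R powr (1 - a) * (1 + t) * (q ^ k * (real k + 1))" for k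
  proof -
    let ?d = "R / 2 ^ k"
    have d: "?d \<in> {0<..B}" by (rule dyadic_range[OF R])
    then have L0: "0 \<le> L ?d" using card_net[OF ne] by auto
    define X Y Z where "X = sqrt (2 * (5 * L ?d + (real k + 1) + t\<^sup>2))"
      and "Y = sqrt (10 * L ?d)" and "Z = sqrt (2 * ((real k + 1) + t\<^sup>2))"
    have "X \<le> Y + Z"
      unfolding X_def Y_def Z_def
      using sqrt_add_le_add_sqrt[of "10 * L ?d" "2 * ((real k + 1) + t\<^sup>2)"] L0 by (simp add: algebra_simps)
    moreover have "Y \<le> 4 * sqrt (L ?d)"
      unfolding Y_def using L0 by (intro real_le_lsqrt) (auto simp: power_mult_distrib)
    moreover
    have "Z \<le> 2 * ((real k + 1) + t)"
      unfolding Z_def using t by (intro sqrt_double_le) auto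
    then have "Z \<le> 2 * real k + 2 + 2 * t" by simp
    \<comment> \<open>The product dominates the sum \<open>(real k + 1) + t\<close> and factors the
      dependence on \<open>t\<close> out of the sum over \<open>k\<close>.\<close>
    moreover define P where "P = (1 + t) * (real k + 1)"
    moreover have "(real k + 1) + t \<le> P" using t by (simp add: P_def algebra_simps)
    ultimately have "X \<le> 4 * sqrt (L ?d) + 2 * P" by linarith
    then have "8 * c * ?d powr (1 - a) * X
        \<le> 8 * c * ?d powr (1 - a) * (4 * sqrt (L ?d) + 2 * P)"
      using c by (intro mult_left_mono) auto
    also have "\<dots> = 32 * (c * ?d powr (1 - a) * sqrt (L ?d)) + 16 * c * ?d powr (1 - a) * P"
      by (simp add: algebra_simps)
    also have "\<dots> = 32 * (?d * H ?d) + 16 * c * R powr (1 - a) * (1 + t) * (q ^ k * (real k + 1))"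
    proof -
      have "?d powr (1 - a) = ?d * ?d powr (- a)" using d R powr_add[of ?d 1 "- a"] by simp
      then have "c * ?d powr (1 - a) * sqrt (L ?d) = ?d * H ?d" unfolding H_eq[OF d] by simp
      moreover have "?d powr (1 - a) = R powr (1 - a) * q ^ k" using R by (intro powr_dyadic) auto
      ultimately show ?thesis by (simp only: mult_ac P_def)
    qed
    finally show ?thesis unfolding X_def .
  qed
  have "(\<Sum>k<n. 8 * c * (R / 2 ^ k) powr (1 - a) *
      sqrt (2 * (5 * L (R / 2 ^ k) + (real k + 1) + t\<^sup>2)))
    \<le> (\<Sum>k<n. 32 * (R / 2 ^ k * H (R / 2 ^ k)) + 16 * c * R powr (1 - a) * (1 + t) * (q ^ k * (real k + 1)))"
    by (rule sum_mono) (rule summand)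
  also have "\<dots> = 32 * (\<Sum>k<n. R / 2 ^ k * H (R / 2 ^ k))
      + 16 * c * R powr (1 - a) * (1 + t) * (\<Sum>k<n. q ^ k * (real k + 1))"
    unfolding sum.distrib sum_distrib_left ..
  also have "\<dots> \<le> 32 * (2 * G R) + 16 * c * R powr (1 - a) * (1 + t) * S"
    using c t by (intro add_mono mult_left_mono dyadic_sum_le_G[OF R] S) auto
  finally show ?thesis by (simp add: mult_ac)
qed

text \<open>Each chain runs from the root \<open>proj (2 * R) f\<close> through finitely many links
  to a projection of \<open>gs i\<close>, followed by one end jump to \<open>gs i\<close>; one more
  end jump joins the root to \<open>f\<close>. Links and end jumps each get their own exceptional
  event.\<close>

lemma chain_bound:
  assumes f: "f \<in> F" and gs: "\<And>i :: nat. gs i \<in> F" and R: "R \<in> {0<..B}" and t: "0 \<le> t"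
  shows "\<exists>Bad \<in> events. prob Bad \<le> 4 * exp (- t\<^sup>2) \<and>
    (\<forall>\<omega> \<in> space \<Omega> - Bad. \<forall>i. L2_dist M (gs i) f < 5 * R \<longrightarrow>
      \<bar>W (Q (gs i)) \<omega> - W (Q f) \<omega>\<bar> \<le> 64 * G R + (16 * c * S + 4 * c1) * R powr (1 - a) * (1 + t))"
proof -
  have ne: "F \<noteq> {}" using f by auto
  have d: "R / 2 ^ k \<in> {0<..B}" "0 < R / 2 ^ k" for k using dyadic_range[OF R, of k] by auto
  have L0: "0 \<le> L (R / 2 ^ k)" for k by (rule card_net(2)[OF ne d(2)])
  \<comment> \<open>The chain for \<open>gs i\<close> stops at a level so fine that the end jump
    outweighs the threshold, which grows with \<open>i\<close> in the union over countably many
    points.\<close>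
  have "\<exists>n. q ^ n * (real i + 2) \<le> 1" for i
  proof -
    obtain n where "q ^ n < 1 / (real i + 2)" using real_arch_pow_inv[of "1 / (real i + 2)" q] q by auto
    then show ?thesis by (intro exI[of _ n]) (simp add: field_simps)
  qed
  then obtain K where K: "\<And>i. q ^ K i * (real i + 2) \<le> 1" by metis
  define \<sigma> where "\<sigma> k = 8 * c * (R / 2 ^ k) powr (1 - a)" for k
  define s where "s k = sqrt (2 * (5 * L (R / 2 ^ k) + (real k + 1) + t\<^sup>2))" for k
  \<comment> \<open>Index 0 is reserved for the jump between \<open>f\<close> and the root, and
    \<open>Suc j\<close> for the end jump of \<open>gs j\<close>. Every set is a singleton, so no
    entropy enters.\<close>
  define E where "E i = {case i of 0 \<Rightarrow> (f, proj (2 * R) f) | Suc j \<Rightarrow> (gs j, proj (R / 2 ^ K j) (gs j))}" for i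
  define \<tau> where "\<tau> i = c1 * (case i of 0 \<Rightarrow> R powr (1 - a) | Suc j \<Rightarrow> R powr (1 - a) * q ^ Suc (K j))" for i
  have \<sigma>_pos: "0 < \<sigma> k" for k using c R by (simp add: \<sigma>_def)
  have \<tau>_pos: "0 < \<tau> i" for i using c1_pos R q by (cases i) (simp_all add: \<tau>_def)
  have E_dom: "\<phi> \<in> D_Q \<and> \<xi> \<in> D_Q \<and> L2_dist \<nu> (Q \<phi>) (Q \<xi>) \<le> \<tau> i" if "(\<phi>, \<xi>) \<in> E i" for \<phi> \<xi> i
  proof (cases i)
    case 0
    then show ?thesis using that Q_proj_dist[OF f R] F_D_Q[OF f] proj(3)[OF f, of "2 * R"] R
      by (simp add: E_def \<tau>_def)
  next
    case (Suc j)
    have "L2_dist \<nu> (Q (gs j)) (Q (proj (2 * (R / 2 ^ Suc (K j))) (gs j))) \<le> c1 * (R / 2 ^ Suc (K j)) powr (1 - a)"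
      by (rule Q_proj_dist[OF gs d(1)])
    moreover have "2 * (R / 2 ^ Suc (K j)) = R / 2 ^ K j" by simp
    moreover have "(R / 2 ^ Suc (K j)) powr (1 - a) = R powr (1 - a) * q ^ Suc (K j)"
      using R by (intro powr_dyadic) auto
    ultimately show ?thesis using that Suc F_D_Q[OF gs] proj(3)[OF gs d(2)]
      by (simp add: E_def \<tau>_def)
  qed
  have "\<exists>Bad \<in> events. prob Bad \<le> 2 * exp (- t\<^sup>2) \<and>
      (\<forall>\<omega> \<in> space \<Omega> - Bad. \<forall>k. \<forall>(\<phi>, \<xi>) \<in> links R f k.
        \<bar>W (Q \<phi>) \<omega> - W (Q \<xi>) \<omega>\<bar> \<le> \<sigma> k * sqrt (2 * (5 * L (R / 2 ^ k) + (real k + 1) + t\<^sup>2)))"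
    using finite_links[OF f R] links_dom[OF f R] L0 \<sigma>_pos
    by (intro union_tail_bound[where X = "\<lambda>\<phi>. W (Q \<phi>)"] conjI W_measurable W_tail) (auto simp: \<sigma>_def)
  then obtain Bad1 where Bad1: "Bad1 \<in> events" "prob Bad1 \<le> 2 * exp (- t\<^sup>2)"
    and good1: "\<And>\<omega> k \<phi> \<xi>. \<omega> \<in> space \<Omega> - Bad1 \<Longrightarrow> (\<phi>, \<xi>) \<in> links R f k \<Longrightarrow>
      \<bar>W (Q \<phi>) \<omega> - W (Q \<xi>) \<omega>\<bar> \<le> \<sigma> k * s k"
    unfolding s_def by blast
  have "\<exists>Bad \<in> events. prob Bad \<le> 2 * exp (- t\<^sup>2) \<and>
      (\<forall>\<omega> \<in> space \<Omega> - Bad. \<forall>i. \<forall>(\<phi>, \<xi>) \<in> E i.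
        \<bar>W (Q \<phi>) \<omega> - W (Q \<xi>) \<omega>\<bar> \<le> \<tau> i * sqrt (2 * (0 + (real i + 1) + t\<^sup>2)))"
    using E_dom \<tau>_pos
    by (intro union_tail_bound[where X = "\<lambda>\<phi>. W (Q \<phi>)"] conjI W_measurable W_tail) (auto simp: E_def)
  then obtain Bad2 where Bad2: "Bad2 \<in> events" "prob Bad2 \<le> 2 * exp (- t\<^sup>2)"
    and good2: "\<And>\<omega> i \<phi> \<xi>. \<omega> \<in> space \<Omega> - Bad2 \<Longrightarrow> (\<phi>, \<xi>) \<in> E i \<Longrightarrow>
      \<bar>W (Q \<phi>) \<omega> - W (Q \<xi>) \<omega>\<bar> \<le> \<tau> i * sqrt (2 * (0 + (real i + 1) + t\<^sup>2))"
    by blast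
  \<comment> \<open>The choice of \<open>K\<close> cancels the growth of the threshold, so all end
    jumps share one bound independent of the index.\<close>
  have \<tau>_bound: "\<tau> i * sqrt (2 * (0 + (real i + 1) + t\<^sup>2)) \<le> 2 * (c1 * R powr (1 - a) * (1 + t))" for i
  proof -
    define r where "r = (case i of 0 \<Rightarrow> 1 | Suc j \<Rightarrow> q ^ Suc (K j))"
    have r: "0 \<le> r" "r \<le> 1" "r * (real i + 1) \<le> 1"
    proof -
      show "0 \<le> r" "r \<le> 1" using q by (auto simp: r_def split: nat.split intro!: mult_le_one power_le_one)
      show "r * (real i + 1) \<le> 1"
      proof (cases i)
        case (Suc j)
        have "q * (q ^ K j * (real j + 2)) \<le> 1 * 1"
          by (rule mult_mono) (use q K[of j] in auto)
        then show ?thesis using Suc by (simp add: r_def algebra_simps)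
      qed (simp add: r_def)
    qed
    have "\<tau> i = c1 * R powr (1 - a) * r" by (simp add: \<tau>_def r_def split: nat.split)
    moreover have "sqrt (2 * (0 + (real i + 1) + t\<^sup>2)) \<le> 2 * ((real i + 1) + t)"
      using t sqrt_double_le[of "real i + 1" t] by simp
    ultimately have "\<tau> i * sqrt (2 * (0 + (real i + 1) + t\<^sup>2))
        \<le> c1 * R powr (1 - a) * r * (2 * ((real i + 1) + t))"
      using c1_pos r by (intro mult_mono) auto
    also have "\<dots> = 2 * (c1 * R powr (1 - a) * (r * (real i + 1) + r * t))" by (simp add: algebra_simps)
    also have "\<dots> \<le> 2 * (c1 * R powr (1 - a) * (1 + t))"
      using c1_pos r t mult_right_mono[OF r(2) t] by (intro mult_left_mono add_mono) auto
    finally show ?thesis .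
  qed
  have main: "\<bar>W (Q (gs i)) \<omega> - W (Q f) \<omega>\<bar> \<le> 64 * G R + (16 * c * S + 4 * c1) * R powr (1 - a) * (1 + t)"
    if \<omega>: "\<omega> \<in> space \<Omega> - (Bad1 \<union> Bad2)" and dist: "L2_dist M (gs i) f < 5 * R" for \<omega> i
  proof -
    let ?X = "\<lambda>\<phi>. W (Q \<phi>) \<omega>"
    \<comment> \<open>Here the radius \<open>5 * R\<close> is used: \<open>3 * R + 5 * R\<close> is
      the admissible length of a level 0 link.\<close>
    have link0: "(proj (R / 2 ^ 0) (gs i), proj (2 * R) f) \<in> links R f 0"
      using proj(1)[OF gs[of i] d(2)[of 0]] dist_proj_proj[OF gs[of i] f, of R] dist R by (simp add: links_def)
    have links_Suc: "(proj (R / 2 ^ Suc k) (gs i), proj (R / 2 ^ k) (gs i)) \<in> links R f (Suc k)" for k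
    proof -
      have eq: "2 * (R / 2 ^ Suc k) = R / 2 ^ k" by simp
      have "L2_dist M (proj (R / 2 ^ Suc k) (gs i)) (proj (R / 2 ^ k) (gs i)) \<le> 8 * (R / 2 ^ Suc k)"
        using dist_proj_proj[OF gs[of i] gs[of i] d(2)[of "Suc k"]] d(2)[of "Suc k"] L2_dist_self[of M "gs i"]
        unfolding eq by linarith
      then show ?thesis
        using proj(1)[OF gs[of i] d(2)[of "Suc k"]] proj(1)[OF gs[of i] d(2)[of k]]
        unfolding links_def mem_Collect_eq case_prod_conv eq by (simp del: power_Suc)
    qed
    have chain: "\<bar>?X (proj (R / 2 ^ m) (gs i)) - ?X (proj (2 * R) f)\<bar> \<le> (\<Sum>k<Suc m. \<sigma> k * s k)" for m
    proof (induction m)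
      case 0
      show ?case using good1[OF _ link0, of \<omega>] \<omega> by simp
    next
      case (Suc m)
      then show ?case using good1[OF _ links_Suc, of \<omega> m] \<omega> by simp
    qed
    have "\<bar>?X (gs i) - ?X (proj (R / 2 ^ K i) (gs i))\<bar> \<le> 2 * (c1 * R powr (1 - a) * (1 + t))"
      using good2[of \<omega> "gs i" "proj (R / 2 ^ K i) (gs i)" "Suc i"] \<omega> \<tau>_bound[of "Suc i"] by (simp add: E_def)
    moreover have "\<bar>?X f - ?X (proj (2 * R) f)\<bar> \<le> 2 * (c1 * R powr (1 - a) * (1 + t))"
      using good2[of \<omega> f "proj (2 * R) f" 0] \<omega> \<tau>_bound[of 0] by (simp add: E_def)
    moreover have "(\<Sum>k<Suc (K i). \<sigma> k * s k) \<le> 64 * G R + 16 * c * S * R powr (1 - a) * (1 + t)"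
      unfolding \<sigma>_def s_def by (rule chain_sum[OF ne R t])
    moreover note chain[of "K i"]
    moreover have "(16 * c * S + 4 * c1) * R powr (1 - a) * (1 + t)
        = 16 * c * S * R powr (1 - a) * (1 + t) + 4 * (c1 * R powr (1 - a) * (1 + t))"
      by (simp add: algebra_simps)
    ultimately show ?thesis by linarith
  qed
  have "prob (Bad1 \<union> Bad2) \<le> 4 * exp (- t\<^sup>2)"
    using measure_Un_le[OF Bad1(1) Bad2(1)] Bad1(2) Bad2(2) by linarith
  with main Bad1(1) Bad2(1) show ?thesis by (intro bexI[of _ "Bad1 \<union> Bad2"]) auto
qed

text \<open>Separability extends the bound from a countable subset to all of \<open>F\<close>.\<close>

lemma modulus_bound:
  "\<exists>K>0. \<forall>f\<in>F. \<forall>R\<in>{0<..B}. \<forall>t\<ge>0. \<exists>Bad \<in> events. prob Bad \<le> 4 * exp (- t\<^sup>2) \<and>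
    (AE \<omega> in \<Omega>. \<omega> \<notin> Bad \<longrightarrow> (\<forall>g \<in> F. L2_dist M g f < 5 * R \<longrightarrow>
      \<bar>W (Q g) \<omega> - W (Q f) \<omega>\<bar> \<le> K * (1 + t) * G R))"
proof -
  \<comment> \<open>The limit assumption on \<open>G\<close> lets the pure fluctuation term
    \<open>R powr (1 - a)\<close> be absorbed by \<open>G R\<close>.\<close>
  obtain \<kappa> where \<kappa>: "0 < \<kappa>" "\<And>R. R \<in> {0<..B} \<Longrightarrow> R powr (1 - a) \<le> \<kappa> * G R"
    using powr_le_G[OF G_lim a(2)] by blast
  define C where "C = 16 * c * S + 4 * c1"
  have C: "0 < C" using c S c1_pos by (simp add: C_def add_pos_pos)
  obtain F0 where F0: "F0 \<subseteq> F" "countable F0"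
    and sep: "AE \<omega> in \<Omega>. \<forall>g \<in> F. \<exists>s :: nat \<Rightarrow> 'x \<Rightarrow> real.
           range s \<subseteq> F0 \<and> (\<lambda>k. L2_dist M (s k) g) \<longlonglongrightarrow> 0 \<and> (\<lambda>k. W (Q (s k)) \<omega>) \<longlonglongrightarrow> W (Q g) \<omega>"
    using separable unfolding separable_process_def by blast
  show ?thesis
  proof (intro exI[of _ "64 + C * \<kappa>"] conjI ballI allI impI)
    show "0 < 64 + C * \<kappa>" using C \<kappa> by (simp add: add_pos_pos)
    fix f R and t :: real assume f: "f \<in> F" and R: "R \<in> {0<..B}" and t: "0 \<le> t"
    let ?b = "64 * G R + C * R powr (1 - a) * (1 + t)" and ?K = "(64 + C * \<kappa>) * (1 + t) * G R"
    have b: "?b \<le> ?K"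
    proof -
      have "C * (1 + t) * R powr (1 - a) \<le> C * (1 + t) * (\<kappa> * G R)"
        using C t \<kappa>(2)[OF R] by (intro mult_left_mono) auto
      moreover have "64 * G R * 1 \<le> 64 * G R * (1 + t)"
        using G_nonneg[OF R] t by (intro mult_left_mono) auto
      ultimately show ?thesis by (simp add: algebra_simps)
    qed
    \<comment> \<open>Inserting \<open>f\<close> makes the set nonempty, so that
      \<open>from_nat_into\<close> stays inside \<open>F\<close>.\<close>
    define F1 where "F1 = insert f F0"
    have F1: "F1 \<subseteq> F" "countable F1" "F1 \<noteq> {}" using F0 f by (auto simp: F1_def)
    then have gs: "from_nat_into F1 i \<in> F" for i by (meson from_nat_into subsetD)
    obtain Bad where Bad: "Bad \<in> events" "prob Bad \<le> 4 * exp (- t\<^sup>2)"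
      and good: "\<forall>\<omega> \<in> space \<Omega> - Bad. \<forall>i. L2_dist M (from_nat_into F1 i) f < 5 * R \<longrightarrow>
        \<bar>W (Q (from_nat_into F1 i)) \<omega> - W (Q f) \<omega>\<bar> \<le> ?b"
      using chain_bound[of f "from_nat_into F1" R t, OF f gs R t, folded C_def]
      by (elim bexE conjE) (rule that)
    have "AE \<omega> in \<Omega>. \<omega> \<notin> Bad \<longrightarrow> (\<forall>g \<in> F. L2_dist M g f < 5 * R \<longrightarrow>
        \<bar>W (Q g) \<omega> - W (Q f) \<omega>\<bar> \<le> ?K)"
      using sep AE_space
    proof eventually_elim
      case (elim \<omega>)
      show ?case
      proof (intro impI ballI)
        fix g assume "\<omega> \<notin> Bad" and g: "g \<in> F" and dist: "L2_dist M g f < 5 * R"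
        with elim(2) have \<omega>: "\<omega> \<in> space \<Omega> - Bad" by simp
        obtain s :: "nat \<Rightarrow> 'x \<Rightarrow> real" where s: "range s \<subseteq> F0" "(\<lambda>k. L2_dist M (s k) g) \<longlonglongrightarrow> 0"
          "(\<lambda>k. W (Q (s k)) \<omega>) \<longlonglongrightarrow> W (Q g) \<omega>"
          using bspec[OF elim(1) g] by (elim exE conjE)
        have sF: "s k \<in> F1" "s k \<in> F" for k using s(1) F1(1) by (auto simp: F1_def)
        \<comment> \<open>The strict inequality \<open>L2_dist M g f < 5 * R\<close> leaves room for
          the approximating points to lie eventually in the same ball.\<close>
        have "\<forall>\<^sub>F k in sequentially. L2_dist M (s k) g < 5 * R - L2_dist M g f"
          using order_tendstoD(2)[OF s(2)] dist by simp
        then have "\<forall>\<^sub>F k in sequentially. \<bar>W (Q (s k)) \<omega> - W (Q f) \<omega>\<bar> \<le> ?b"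
        proof eventually_elim
          case (elim k)
          have "L2_dist M (s k) f \<le> L2_dist M (s k) g + L2_dist M g f"
            by (intro L2_dist_triangle F_L2 sF g f)
          with elim have "L2_dist M (s k) f < 5 * R" by linarith
          then show ?case
            using good[rule_format, OF \<omega>, of "to_nat_on F1 (s k)"] F1(2) sF(1)[of k] by simp
        qed
        moreover have "(\<lambda>k. \<bar>W (Q (s k)) \<omega> - W (Q f) \<omega>\<bar>) \<longlonglongrightarrow> \<bar>W (Q g) \<omega> - W (Q f) \<omega>\<bar>"
          by (intro tendsto_intros s(3))
        ultimately have "\<bar>W (Q g) \<omega> - W (Q f) \<omega>\<bar> \<le> ?b"
          by (intro tendsto_upperbound[of _ _ sequentially]) auto
        with b show "\<bar>W (Q g) \<omega> - W (Q f) \<omega>\<bar> \<le> ?K" by linarith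
      qed
    qed
    with Bad show "\<exists>Bad \<in> events. prob Bad \<le> 4 * exp (- t\<^sup>2) \<and>
      (AE \<omega> in \<Omega>. \<omega> \<notin> Bad \<longrightarrow> (\<forall>g \<in> F. L2_dist M g f < 5 * R \<longrightarrow>
        \<bar>W (Q g) \<omega> - W (Q f) \<omega>\<bar> \<le> ?K))"
      by (intro bexI[OF _ Bad(1)] conjI)
  qed
qed

subsection \<open>Peeling\<close>

text \<open>The squared error is at most \<open>U\<close> plus the contributions of the exceptional
  events of the shells. On a shell its size \<open>25 * (R j)^2\<close> is paid only with a
  probability that decays faster than any power of \<open>R j\<close>.\<close>

lemma risk_bound:
  fixes X :: "'w \<Rightarrow> 'x \<Rightarrow> real" and \<eta> \<epsilon> \<psi> C K :: real
  assumes K: "0 < K"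
    and modulus: "\<And>R t. R \<in> {0<..B} \<Longrightarrow> 0 \<le> t \<Longrightarrow> \<exists>Bad \<in> events. prob Bad \<le> 4 * exp (- t\<^sup>2) \<and>
      (AE \<omega> in \<Omega>. \<omega> \<notin> Bad \<longrightarrow> (\<forall>g \<in> F. L2_dist M g f < 5 * R \<longrightarrow>
        \<bar>W (Q g) \<omega> - W (Q f) \<omega>\<bar> \<le> K * (1 + t) * G R))"
    and f: "f \<in> F" and bounded: "\<And>g. g \<in> F \<Longrightarrow> L2_norm M g \<le> B"
    and \<psi>: "\<psi> \<in> {0<..B}" and C: "0 < C" and \<eta>: "0 \<le> \<eta>" "C * \<eta> * G \<psi> \<le> \<psi>\<^sup>2" and \<epsilon>: "0 < \<epsilon>"
    and X: "\<And>\<omega>. \<omega> \<in> space \<Omega> \<Longrightarrow> X \<omega> \<in> F"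
    and meas: "(\<lambda>\<omega>. L2_dist M (X \<omega>) f) \<in> borel_measurable \<Omega>"
    and basic: "AE \<omega> in \<Omega>. (L2_dist M (X \<omega>) f)\<^sup>2 \<le> \<epsilon> + 2 * \<eta> * (W (Q (X \<omega>)) \<omega> - W (Q f) \<omega>)"
  shows "(\<integral>\<omega>. (L2_dist M (X \<omega>) f)\<^sup>2 \<partial>\<Omega>)
    \<le> (51 + 50 * (2 * K / C)\<^sup>2 + 400 * (8 * K / C) ^ 4) * (\<psi>\<^sup>2 + \<epsilon>)"
proof -
  \<comment> \<open>\<open>K2\<close> is the factor of the noise on a shell once
    \<open>G (R j)\<close> is replaced by its concavity bound. \<open>\<theta>\<close> makes
    \<open>K2 * \<theta> = 1 / 4\<close>, so the part growing with the confidence level costs only a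
    quarter of \<open>(R j)^2\<close>.\<close>
  define K2 where "K2 = 2 * K / C"
  define \<theta> where "\<theta> = 1 / (4 * K2)"
  define R where "R j = \<psi> * 2 ^ j" for j :: nat
  have K2: "0 < K2" and \<theta>: "0 < \<theta>" "K2 * \<theta> = 1 / 4" using K C by (auto simp: K2_def \<theta>_def)
  have R_pos: "0 < R j" and R_Suc: "R (Suc j) = 2 * R j" for j using \<psi> by (auto simp: R_def)
  obtain m where m: "B / \<psi> < 2 ^ m" using real_arch_pow[of 2 "B / \<psi>"] by auto
  define J where "J = {j \<in> {..<m}. R j \<le> B}"
  have RB: "R j \<in> {0<..B}" if "j \<in> J" for j using that R_pos by (auto simp: J_def)
  have Rm: "B < R m" using m \<psi> by (simp add: R_def divide_less_eq mult.commute)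
  have finJ: "finite J" by (simp add: J_def)
  have "\<forall>j\<in>J. \<exists>Bad \<in> events. prob Bad \<le> 4 * exp (- (\<theta> * 2 ^ j)\<^sup>2) \<and>
      (AE \<omega> in \<Omega>. \<omega> \<notin> Bad \<longrightarrow> (\<forall>g \<in> F. L2_dist M g f < 5 * R j \<longrightarrow>
        \<bar>W (Q g) \<omega> - W (Q f) \<omega>\<bar> \<le> K * (1 + \<theta> * 2 ^ j) * G (R j)))"
    using \<theta>(1) by (intro ballI modulus RB) simp_all
  from bchoice[OF this[unfolded Bex_def]] obtain Bad where
    Bad': "\<forall>j\<in>J. Bad j \<in> events \<and> prob (Bad j) \<le> 4 * exp (- (\<theta> * 2 ^ j)\<^sup>2) \<and>
      (AE \<omega> in \<Omega>. \<omega> \<notin> Bad j \<longrightarrow> (\<forall>g \<in> F. L2_dist M g f < 5 * R j \<longrightarrow>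
        \<bar>W (Q g) \<omega> - W (Q f) \<omega>\<bar> \<le> K * (1 + \<theta> * 2 ^ j) * G (R j)))" ..
  have Bad: "Bad j \<in> events" "prob (Bad j) \<le> 4 * exp (- (\<theta> * 2 ^ j)\<^sup>2)" if "j \<in> J" for j
    using Bad' that by simp_all
  have "AE \<omega> in \<Omega>. \<forall>j\<in>J. \<omega> \<notin> Bad j \<longrightarrow> (\<forall>g \<in> F. L2_dist M g f < 5 * R j \<longrightarrow>
        \<bar>W (Q g) \<omega> - W (Q f) \<omega>\<bar> \<le> K * (1 + \<theta> * 2 ^ j) * G (R j))"
    using Bad' by (intro AE_finite_allI finJ) simp
  \<comment> \<open>\<open>\<psi>^2\<close> covers errors below the innermost radius; the other two
    terms cover shells on which the noise is controlled.\<close>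
  define U where "U = \<psi>\<^sup>2 + 50 * K2\<^sup>2 * \<psi>\<^sup>2 + 50 * \<epsilon>"
  have U: "\<psi>\<^sup>2 \<le> U" "50 * K2\<^sup>2 * \<psi>\<^sup>2 + 50 * \<epsilon> \<le> U" "0 \<le> U" using \<epsilon> by (simp_all add: U_def)
  have pointwise: "AE \<omega> in \<Omega>. (L2_dist M (X \<omega>) f)\<^sup>2 \<le> U + (\<Sum>j\<in>J. 25 * (R j)\<^sup>2 * indicator (Bad j) \<omega>)"
    using \<open>AE \<omega> in \<Omega>. \<forall>j\<in>J. _ \<omega> j\<close> basic AE_space
  proof eventually_elim
    case (elim \<omega>)
    define x where "x = L2_dist M (X \<omega>) f"
    have XF: "X \<omega> \<in> F" using X elim(3) by simp
    have sum_nonneg: "0 \<le> (\<Sum>j\<in>J. 25 * (R j)\<^sup>2 * indicator (Bad j) \<omega>)" by (intro sum_nonneg) simp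
    have x0: "0 \<le> x" by (simp add: x_def)
    have xB: "x \<le> 2 * B"
      using L2_dist_le_norms[OF F_L2[OF XF] F_L2[OF f]] bounded[OF XF] bounded[OF f] by (simp add: x_def)
    show ?case
    proof (cases "x < \<psi>")
      case True
      then have "x\<^sup>2 \<le> \<psi>\<^sup>2" using x0 by (intro power_mono) auto
      then show ?thesis using U(1) sum_nonneg by (simp add: x_def)
    next
      case False
      \<comment> \<open>The error may reach \<open>2 * B\<close> while the modulus is available only
        for radii up to \<open>B\<close>. Capping at \<open>B\<close> selects a shell with
        \<open>min x B < 2 * R j\<close>, hence \<open>x < 4 * R j\<close>, within the radius
        \<open>5 * R j\<close>.\<close>
      have "min x B < R m" using Rm by simp
      moreover have "\<not> min x B < R 0" using False \<psi> by (auto simp: R_def)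
      ultimately obtain j where j: "j < m" "\<not> min x B < R j" "min x B < R (Suc j)"
        using ex_least_nat_less[of "\<lambda>j. min x B < R j" m] by blast
      then have jJ: "j \<in> J" by (simp add: J_def)
      have Rx: "R j \<le> x" "x < 5 * R j" using j xB R_pos[of j] R_Suc[of j] by auto
      have "x\<^sup>2 \<le> (5 * R j)\<^sup>2" using Rx(2) x0 by (intro power_mono) auto
      then have x25: "x\<^sup>2 \<le> 25 * (R j)\<^sup>2" by (simp add: power_mult_distrib)
      show ?thesis
      proof (cases "\<omega> \<in> Bad j")
        case True
        have "25 * (R j)\<^sup>2 * indicator (Bad j) \<omega> \<le> (\<Sum>j\<in>J. 25 * (R j)\<^sup>2 * indicator (Bad j) \<omega>)"
          by (rule member_le_sum[OF jJ _ finJ]) simp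
        then show ?thesis using True x25 U(3) by (simp add: x_def)
      next
        case False
        have "\<bar>W (Q (X \<omega>)) \<omega> - W (Q f) \<omega>\<bar> \<le> K * (1 + \<theta> * 2 ^ j) * G (R j)"
          using elim(1) jJ False XF Rx(2) by (simp add: x_def)
        then have "W (Q (X \<omega>)) \<omega> - W (Q f) \<omega> \<le> K * (1 + \<theta> * 2 ^ j) * G (R j)" by linarith
        then have "2 * \<eta> * (W (Q (X \<omega>)) \<omega> - W (Q f) \<omega>) \<le> 2 * \<eta> * (K * (1 + \<theta> * 2 ^ j) * G (R j))"
          using \<eta>(1) by (intro mult_left_mono) auto
        also have "\<dots> = 2 * K * (1 + \<theta> * 2 ^ j) * (\<eta> * G (R j))" by simp
        also have "\<dots> \<le> 2 * K * (1 + \<theta> * 2 ^ j) * (R j * \<psi> / C)"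
        proof (rule mult_left_mono)
          have "G (R j) \<le> R j / \<psi> * G \<psi>"
            using \<psi> RB[OF jJ] by (intro G_ratio) (auto simp: R_def)
          then have "\<eta> * G (R j) \<le> \<eta> * (R j / \<psi> * G \<psi>)" using \<eta>(1) by (rule mult_left_mono)
          also have "\<dots> = R j / (\<psi> * C) * (C * \<eta> * G \<psi>)" using C by simp
          also have "\<dots> \<le> R j / (\<psi> * C) * \<psi>\<^sup>2"
            using \<eta>(2) C \<psi> R_pos[of j] by (intro mult_left_mono) auto
          also have "\<dots> = R j * \<psi> / C" using \<psi> by (simp add: power2_eq_square)
          finally show "\<eta> * G (R j) \<le> R j * \<psi> / C" .
        qed (use K \<theta> in auto)
        also have "\<dots> = K2 * \<psi> * R j + (K2 * \<theta>) * (\<psi> * 2 ^ j) * R j"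
          by (simp add: K2_def algebra_simps add_divide_distrib)
        also have "\<dots> = K2 * \<psi> * R j + 1 / 4 * (R j)\<^sup>2"
          unfolding \<theta>(2) R_def[symmetric] by (simp add: power2_eq_square)
        finally have "x\<^sup>2 \<le> \<epsilon> + (K2 * \<psi> * R j + 1 / 4 * (R j)\<^sup>2)" using elim(2) unfolding x_def by linarith
        moreover have "(R j)\<^sup>2 \<le> x\<^sup>2" using Rx(1) R_pos[of j] by (intro power_mono) auto
        \<comment> \<open>Completing the square splits the mixed term. Half of
          \<open>(R j)^2\<close> is then left to be bounded, which explains the factor 50 after
          multiplying by 25.\<close>
        moreover have "K2 * \<psi> * R j \<le> 1 / 4 * (R j)\<^sup>2 + K2\<^sup>2 * \<psi>\<^sup>2"
        proof -
          have "0 \<le> (1 / 2 * R j - K2 * \<psi>)\<^sup>2" by simp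
          then show ?thesis by (simp add: power2_eq_square algebra_simps)
        qed
        ultimately have "25 * (R j)\<^sup>2 \<le> 50 * (K2\<^sup>2 * \<psi>\<^sup>2) + 50 * \<epsilon>" by linarith
        then show ?thesis using x25 U(2) sum_nonneg unfolding x_def by linarith
      qed
    qed
  qed
  have int_x: "integrable \<Omega> (\<lambda>\<omega>. (L2_dist M (X \<omega>) f)\<^sup>2)"
  proof (rule integrable_const_bound[where B = "(2 * B)\<^sup>2"])
    show "AE \<omega> in \<Omega>. norm ((L2_dist M (X \<omega>) f)\<^sup>2) \<le> (2 * B)\<^sup>2"
    proof (rule AE_I2)
      fix \<omega> assume "\<omega> \<in> space \<Omega>"
      then have XF: "X \<omega> \<in> F" by (rule X)
      have "L2_dist M (X \<omega>) f \<le> 2 * B"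
        using L2_dist_le_norms[OF F_L2[OF XF] F_L2[OF f]] bounded[OF XF] bounded[OF f] by simp
      then have "(L2_dist M (X \<omega>) f)\<^sup>2 \<le> (2 * B)\<^sup>2" by (rule power_mono) simp
      then show "norm ((L2_dist M (X \<omega>) f)\<^sup>2) \<le> (2 * B)\<^sup>2" by simp
    qed
    show "(\<lambda>\<omega>. (L2_dist M (X \<omega>) f)\<^sup>2) \<in> borel_measurable \<Omega>" using meas by simp
  qed
  have int_Bad: "integrable \<Omega> (\<lambda>\<omega>. 25 * (R j)\<^sup>2 * indicator (Bad j) \<omega>)" if "j \<in> J" for j
    using Bad(1)[OF that] by (simp add: emeasure_eq_measure)
  have "(\<integral>\<omega>. (L2_dist M (X \<omega>) f)\<^sup>2 \<partial>\<Omega>)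
      \<le> (\<integral>\<omega>. U + (\<Sum>j\<in>J. 25 * (R j)\<^sup>2 * indicator (Bad j) \<omega>) \<partial>\<Omega>)"
    by (intro integral_mono_AE int_x pointwise Bochner_Integration.integrable_add
        Bochner_Integration.integrable_sum int_Bad) auto
  also have "\<dots> = U + (\<Sum>j\<in>J. 25 * (R j)\<^sup>2 * prob (Bad j))"
  proof -
    have "(\<integral>\<omega>. U + (\<Sum>j\<in>J. 25 * (R j)\<^sup>2 * indicator (Bad j) \<omega>) \<partial>\<Omega>)
        = (\<integral>\<omega>. U \<partial>\<Omega>) + (\<integral>\<omega>. (\<Sum>j\<in>J. 25 * (R j)\<^sup>2 * indicator (Bad j) \<omega>) \<partial>\<Omega>)"
      by (intro Bochner_Integration.integral_add Bochner_Integration.integrable_sum int_Bad) auto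
    also have "(\<integral>\<omega>. (\<Sum>j\<in>J. 25 * (R j)\<^sup>2 * indicator (Bad j) \<omega>) \<partial>\<Omega>)
        = (\<Sum>j\<in>J. \<integral>\<omega>. 25 * (R j)\<^sup>2 * indicator (Bad j) \<omega> \<partial>\<Omega>)"
      by (intro Bochner_Integration.integral_sum int_Bad)
    also have "\<dots> = (\<Sum>j\<in>J. 25 * (R j)\<^sup>2 * prob (Bad j))"
      using Bad(1) by (intro sum.cong) auto
    finally show ?thesis by (simp add: prob_space)
  qed
  also have "(\<Sum>j\<in>J. 25 * (R j)\<^sup>2 * prob (Bad j)) \<le> (\<Sum>j\<in>J. 200 / \<theta> ^ 4 * \<psi>\<^sup>2 * (1 / 2) ^ j)"
  proof (rule sum_mono)
    fix j assume j: "j \<in> J"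
    let ?y = "(\<theta> * 2 ^ j)\<^sup>2"
    have y: "0 < ?y" using \<theta> by simp
    \<comment> \<open>With \<open>z\<close> equal to \<open>\<theta>^2 * 4 ^ j\<close> this decays
      like \<open>16 ^ j\<close>, while \<open>(R j)^2\<close> grows like \<open>4 ^ j\<close>,
      which leaves a geometric series. The constant 200 is 25 times 4 times 2.\<close>
    have "exp (- z) \<le> 2 / z\<^sup>2" if "0 < z" for z :: real
    proof -
      have "z\<^sup>2 / 2 \<le> exp z" using exp_lower_Taylor_quadratic[of z] that by linarith
      then show ?thesis using that by (simp add: exp_minus field_simps)
    qed
    then have "exp (- ?y) \<le> 2 / ?y\<^sup>2" using y by blast
    then have "25 * (R j)\<^sup>2 * prob (Bad j) \<le> 25 * (R j)\<^sup>2 * (4 * (2 / ?y\<^sup>2))"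
      using Bad(2)[OF j] by (intro mult_left_mono) auto
    also have "\<dots> = 200 / \<theta> ^ 4 * \<psi>\<^sup>2 * (1 / 4) ^ j"
    proof -
      define p where "p = (2 :: real) ^ j"
      have p: "0 < p" "(1 / 4) ^ j = 1 / (p * p)"
        by (simp_all add: p_def power_one_over power_mult_distrib[symmetric])
      have R2: "(R j)\<^sup>2 = \<psi>\<^sup>2 * (p * p)" by (simp add: R_def p_def power2_eq_square)
      have y2: "?y\<^sup>2 = \<theta> ^ 4 * ((p * p) * (p * p))"
        unfolding p_def[symmetric] by (simp add: power2_eq_square power4_eq_xxxx)
      show ?thesis unfolding R2 y2 p(2) using p(1) \<theta>(1) by (simp add: field_simps)
    qed
    also have "\<dots> \<le> 200 / \<theta> ^ 4 * \<psi>\<^sup>2 * (1 / 2) ^ j"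
      using \<theta> by (intro mult_left_mono power_mono) auto
    finally show "25 * (R j)\<^sup>2 * prob (Bad j) \<le> 200 / \<theta> ^ 4 * \<psi>\<^sup>2 * (1 / 2) ^ j" .
  qed
  also have "(\<Sum>j\<in>J. 200 / \<theta> ^ 4 * \<psi>\<^sup>2 * (1 / 2) ^ j) \<le> 200 / \<theta> ^ 4 * \<psi>\<^sup>2 * 2"
  proof -
    have "(\<Sum>j\<in>J. (1 / 2) ^ j) \<le> (\<Sum>j. (1 / 2 :: real) ^ j)"
      using finJ by (intro sum_le_suminf summable_geometric) auto
    also have "\<dots> = 2" using suminf_geometric[of "1 / 2 :: real"] by simp
    finally show ?thesis
      unfolding sum_distrib_left[symmetric] using \<theta> by (intro mult_left_mono) auto
  qed
  finally have final: "(\<integral>\<omega>. (L2_dist M (X \<omega>) f)\<^sup>2 \<partial>\<Omega>) \<le> U + 200 / \<theta> ^ 4 * \<psi>\<^sup>2 * 2" by simp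
  have inv_\<theta>: "1 / \<theta> ^ 4 = (8 * K / C) ^ 4"
    using K C by (simp add: \<theta>_def K2_def power_one_over[symmetric])
  have "U + 200 / \<theta> ^ 4 * \<psi>\<^sup>2 * 2 = (1 + 50 * K2\<^sup>2 + 400 * (8 * K / C) ^ 4) * \<psi>\<^sup>2 + 50 * \<epsilon>"
    unfolding inv_\<theta>[symmetric] U_def by (simp add: algebra_simps)
  also have "\<dots> \<le> (51 + 50 * K2\<^sup>2 + 400 * (8 * K / C) ^ 4) * \<psi>\<^sup>2
      + (51 + 50 * K2\<^sup>2 + 400 * (8 * K / C) ^ 4) * \<epsilon>"
    using \<epsilon> by (intro add_mono mult_right_mono) auto
  finally show ?thesis using final unfolding K2_def distrib_left by linarith
qed

end

section \<open>Risk bound for dense minimizers\<close>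

theorem theorem3:
  fixes \<Omega> :: "'w measure"
    and \<nu> :: "'y measure"
    and A Q :: "(real ^ 'd \<Rightarrow> real) \<Rightarrow> ('y \<Rightarrow> real)"
    and A_inv :: "('y \<Rightarrow> real) \<Rightarrow> (real ^ 'd \<Rightarrow> real)"
    and W :: "('y \<Rightarrow> real) \<Rightarrow> 'w \<Rightarrow> real"
    and F :: "(real ^ 'd \<Rightarrow> real) set"
    and N :: "real \<Rightarrow> (real ^ 'd \<Rightarrow> real) set"
    and fhat :: "(real ^ 'd \<Rightarrow> real) \<Rightarrow> nat \<Rightarrow> 'w \<Rightarrow> (real ^ 'd \<Rightarrow> real)"
    and \<epsilon> \<psi> :: "nat \<Rightarrow> real"
    and a c B2 C :: real
  defines "\<rho> \<equiv> net_operator_norm lborel \<nu> Q N"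
    and "H \<equiv> entropy_integrand lborel \<nu> Q N"
    and "G \<equiv> entropy_integral lborel \<nu> Q N"
    and "\<gamma> \<equiv> empirical_risk lborel \<nu> A Q W"
    and "D_Q \<equiv> L2_adjoint_domain \<nu> lborel (L2_range lborel \<nu> A) A_inv"
  assumes prob: "prob_space \<Omega>"
    and A: "L2_linear_operator lborel \<nu> A"
    and A_inv: "L2_inverse lborel \<nu> A A_inv"
    and Q: "L2_adjoint \<nu> lborel (L2_range lborel \<nu> A) A_inv Q"
    and W: "white_noise \<Omega> \<nu> W"
    and F_L2: "F \<subseteq> L2_space lborel"
    and F_dom: "F \<subseteq> D_Q"
    and F_bounded: "\<And>g. g \<in> F \<Longrightarrow> L2_norm lborel g \<le> B2"
    and W_separable: "separable_process \<Omega> lborel F (\<lambda>g. W (Q g))"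
    and nets: "\<And>\<delta>. 0 < \<delta> \<Longrightarrow> L2_net lborel \<delta> F (N \<delta>)"
    and nets_dom: "\<And>\<delta>. 0 < \<delta> \<Longrightarrow> N \<delta> \<subseteq> D_Q"
    and G_converges: "\<And>\<delta>. \<delta> \<in> {0<..B2} \<Longrightarrow> set_integrable lborel {0<..\<delta>} H"
    and G_decreasing: "antimono_on {0<..B2} (\<lambda>\<delta>. G \<delta> / \<delta>\<^sup>2)"
    and a: "0 \<le> a" "a < 1"
    and c: "0 < c"
    and rho: "\<And>\<delta>. \<delta> \<in> {0<..B2} \<Longrightarrow> \<rho> \<delta> = c * \<delta> powr (- a)"
    and G_limit: "filterlim (\<lambda>\<delta>. G \<delta> * \<delta> powr (a - 1)) at_top (at_right 0)"
    and H_decreasing: "antimono_on {0<..B2} H"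
    and eps: "\<And>n. 1 \<le> n \<Longrightarrow> 0 < \<epsilon> n"
    and fhat_random: "\<And>f n. f \<in> F \<Longrightarrow> 1 \<le> n \<Longrightarrow> L2_random_element \<Omega> lborel (fhat f n)"
    and fhat_in_F: "\<And>f n \<omega>. f \<in> F \<Longrightarrow> 1 \<le> n \<Longrightarrow> \<omega> \<in> space \<Omega> \<Longrightarrow> fhat f n \<omega> \<in> F"
    and fhat_minimizer: "\<And>f n. f \<in> F \<Longrightarrow> 1 \<le> n \<Longrightarrow>
          AE \<omega> in \<Omega>. ereal (\<gamma> f n (fhat f n \<omega>) \<omega>) \<le> (INF g \<in> F. ereal (\<gamma> f n g \<omega>)) + ereal (\<epsilon> n)"
    and C: "0 < C"
    and psi_range: "\<And>n. 1 \<le> n \<Longrightarrow> \<psi> n \<in> {0<..B2}"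
    and psi: "\<And>n. 1 \<le> n \<Longrightarrow> C * real n powr (-1/2) * G (\<psi> n) \<le> (\<psi> n)\<^sup>2"
    and psi_limit: "filterlim (\<lambda>n. real n * \<psi> n powr (2 * (1 + a))) at_top sequentially"
  shows "\<exists>C'>0. \<forall>\<^sub>F n in sequentially. \<forall>f \<in> F.
           (\<integral>\<omega>. (L2_dist lborel (fhat f n \<omega>) f)\<^sup>2 \<partial>\<Omega>) \<le> C' * ((\<psi> n)\<^sup>2 + \<epsilon> n)"
proof -
  have H_nonneg: "0 \<le> entropy_integrand lborel \<nu> Q N u" if "u \<in> {0<..B2}" for u
  proof -
    \<comment> \<open>The case of an empty net is harmless because the logarithm of 0 has the
      default value 0.\<close>
    have "0 \<le> ln (real (card (N u)))" by (cases "card (N u)") auto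
    then show ?thesis using rho[OF that] c unfolding \<rho>_def entropy_integrand_def by simp
  qed
  have H: "decreasing_integrand (entropy_integrand lborel \<nu> Q N) B2"
    by (unfold_locales; (fact H_nonneg H_decreasing[unfolded H_def] G_converges[unfolded H_def])?)
  have G_eq: "G = decreasing_integrand.G (entropy_integrand lborel \<nu> Q N)"
    by (rule ext) (simp add: G_def entropy_integral_def decreasing_integrand.G_def[OF H])
  interpret wn: white_noise_nets lborel \<nu> A Q A_inv F N B2 a c \<Omega> W
  proof (intro white_noise_nets.intro adjoint_nets.intro white_noise_nets_axioms.intro)
    show "filterlim (\<lambda>\<delta>. decreasing_integrand.G (entropy_integrand lborel \<nu> Q N) \<delta> * \<delta> powr (a - 1))
        at_top (at_right 0)"
      using G_limit unfolding G_eq .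
  qed (fact prob A A_inv Q W F_dom[unfolded D_Q_def] nets nets_dom[unfolded D_Q_def] a c
      rho[unfolded \<rho>_def] W_separable H)+
  from wn.modulus_bound obtain K where K: "0 < K"
    and modulus: "\<forall>f\<in>F. \<forall>R\<in>{0<..B2}. \<forall>t\<ge>0. \<exists>Bad \<in> sets \<Omega>. measure \<Omega> Bad \<le> 4 * exp (- t\<^sup>2) \<and>
      (AE \<omega> in \<Omega>. \<omega> \<notin> Bad \<longrightarrow> (\<forall>g \<in> F. L2_dist lborel g f < 5 * R \<longrightarrow>
        \<bar>W (Q g) \<omega> - W (Q f) \<omega>\<bar> \<le> K * (1 + t) * wn.G R))"
    by (elim exE conjE)
  \<comment> \<open>The constant is built from \<open>K\<close> and \<open>C\<close> alone, so it
    serves all \<open>n\<close> and all signals in \<open>F\<close>.\<close>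
  define C' where "C' = 51 + 50 * (2 * K / C)\<^sup>2 + 400 * (8 * K / C) ^ 4"
  have "0 < C'" unfolding C'_def by (intro add_pos_nonneg) auto
  have risk: "(\<integral>\<omega>. (L2_dist lborel (fhat f n \<omega>) f)\<^sup>2 \<partial>\<Omega>) \<le> C' * ((\<psi> n)\<^sup>2 + \<epsilon> n)"
    if n: "1 \<le> n" and f: "f \<in> F" for n f
    unfolding C'_def
  proof (rule wn.risk_bound[where \<eta> = "real n powr (-1/2)"])
    have fL2: "f \<in> L2_space lborel" using f F_L2 by auto
    show "C * real n powr (-1/2) * wn.G (\<psi> n) \<le> (\<psi> n)\<^sup>2"
      using psi[OF n] unfolding G_eq .
    show "(\<lambda>\<omega>. L2_dist lborel (fhat f n \<omega>) f) \<in> borel_measurable \<Omega>"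
      using fhat_random[OF f n] fL2 by (simp add: L2_random_element_def)
    show "AE \<omega> in \<Omega>. (L2_dist lborel (fhat f n \<omega>) f)\<^sup>2
        \<le> \<epsilon> n + 2 * real n powr (-1/2) * (W (Q (fhat f n \<omega>)) \<omega> - W (Q f) \<omega>)"
      using fhat_minimizer[OF f n] AE_space
    proof eventually_elim
      case (elim \<omega>)
      let ?g = "fhat f n \<omega>"
      have g: "?g \<in> F" using fhat_in_F[OF f n] elim(2) by simp
      then have gL2: "?g \<in> L2_space lborel" using F_L2 by auto
      \<comment> \<open>The true signal belongs to \<open>F\<close> and serves as competitor, so the
        infimum need not be attained.\<close>
      have "(INF g \<in> F. ereal (\<gamma> f n g \<omega>)) \<le> ereal (\<gamma> f n f \<omega>)" by (rule INF_lower[OF f])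
      then have "(INF g \<in> F. ereal (\<gamma> f n g \<omega>)) + ereal (\<epsilon> n) \<le> ereal (\<gamma> f n f \<omega>) + ereal (\<epsilon> n)"
        by (rule add_right_mono)
      with elim(1) have "ereal (\<gamma> f n ?g \<omega>) \<le> ereal (\<gamma> f n f \<omega>) + ereal (\<epsilon> n)" by (rule order_trans)
      then have min: "\<gamma> f n ?g \<omega> \<le> \<gamma> f n f \<omega> + \<epsilon> n" by simp
      \<comment> \<open>With the drift written as an inner product, comparing \<open>?g\<close> with
        \<open>f\<close> completes the square to the squared distance, leaving only the noise
        increment and \<open>\<epsilon> n\<close>.\<close>
      have \<gamma>: "\<gamma> f n h \<omega> = - 2 * (L2_inner lborel h f + real n powr (-1/2) * W (Q h) \<omega>) + (L2_norm lborel h)\<^sup>2"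
        if "h \<in> F" for h
        unfolding \<gamma>_def empirical_risk_def observation_integral_def
        using wn.inner_A_Q[OF fL2 wn.F_D_Q[OF that]] by simp
      show ?case
        using min unfolding \<gamma>[OF g] \<gamma>[OF f] L2_dist_square[OF gL2 fL2] L2_inner_self
        by (simp add: algebra_simps)
    qed
  qed (fact K C f psi_range[OF n] eps[OF n] F_bounded fhat_in_F[OF f n]
      modulus[rule_format, OF f] powr_ge_zero)+
  show ?thesis
    using \<open>0 < C'\<close> risk by (intro exI[of _ C'] conjI eventually_sequentiallyI[of 1] ballI) auto
qed

end
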